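(* Let $0<\beta<1$, let $N_\beta$ be the $\beta$-fractional Poisson process, and let $p_n(t)=P\{N_\beta(t)=n\}$. Then for every $t>0$ and every $n=0,1,2,\dots$, $$p_n(t)=\frac{1}{n!}\int_0^\infty t_*^{\,n}\,e^{-t_*}\,q_\beta(t_*,t)\,dt_*=\frac{1}{n!}\int_0^\infty t_*^{\,n}\,t^{-\beta}\,e^{-t_*}\,M_\beta\!\left(t_*\,t^{-\beta}\right)dt_*,$$ where $q_\beta(\cdot,t)$ is the probability density (in $t_*$) of the inverse stable subordinator of order $\beta$ at time $t$, and $M_\beta$ is the $M$-Wright function of order $\beta$.
   Context: The $\beta$-fractional Poisson process $N_\beta$ is the counting process $N_\beta(t)=\max\{n\ge 0: t_n\le t\}$ of a renewal process $0=t_0<t_1<t_2<\cdots$ with i.i.d. positive waiting times $T_j=t_j-t_{j-1}$, $j\ge 1$, satisfying $P(T_j>t)=E_\beta(-t^\beta)$ for $t\ge 0$. Here $E_\beta(z)=\sum_{n=0}^\infty \frac{z^n}{\Gamma(\beta n+1)}$ is the Mittag-Leffler function. Let $(t(t_* ))_{t_*\ge 0}$ be the $\beta$-stable subordinator (nondecreasing càdlàg Lévy process started at $0$) with $\mathbb{E}[e^{-s\,t(t_* )}]=e^{-t_* s^\beta}$ for $s\ge 0$. The inverse stable subordinator of order $\beta$ is $t_*(t)=\inf\{\tau\ge 0: t(\tau)>t\}$. For $t>0$, $q_\beta(t_*,t)$ denotes the density of the random variable $t_*(t)$ at the point $t_*>0$; its Laplace transform with respect to $t$ is $\int_0^\infty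 e^{-st}q_\beta(t_*,t)\,dt=s^{\beta-1}e^{-t_* s^\beta}$ for $s>0$. The $M$-Wright function of order $\nu\in(0,1)$ is $M_\nu(z)=\sum_{n=0}^\infty \frac{(-z)^n}{n!\,\Gamma(-\nu n+1-\nu)}$, with the convention that $1/\Gamma$ vanishes at the poles of $\Gamma$. *)

theory Defs
  imports "HOL-Probability.Probability"
begin

definition mittag_leffler :: "real \<Rightarrow> real \<Rightarrow> real" where
  "mittag_leffler \<beta> z = (\<Sum>n. z ^ n / Gamma (\<beta> * real n + 1))"

(* rGamma is the entire function 1/Gamma, which vanishes at the poles of Gamma. *)
definition M_Wright :: "real \<Rightarrow> real \<Rightarrow> real" where
  "M_Wright \<nu> z = (\<Sum>n. (- z) ^ n / fact n * rGamma (- \<nu> * real n + 1 - \<nu>))"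

text \<open>
  The waiting times are \<open>T 1, T 2, \<dots>\<close>; the value \<open>T 0\<close> plays no role. That they are
  identically distributed is contained in the survival function being the same for all of
  them. The set of which the maximum is taken is almost surely finite, and it
  almost surely contains 0.
\<close>

definition renewal_time :: "(nat \<Rightarrow> 'a \<Rightarrow> real) \<Rightarrow> nat \<Rightarrow> 'a \<Rightarrow> real" where
  "renewal_time T n \<omega> = (\<Sum>j=1..n. T j \<omega>)"

definition fractional_poisson_process ::
    "real \<Rightarrow> 'a measure \<Rightarrow> (real \<Rightarrow> 'a \<Rightarrow> nat) \<Rightarrow> bool" where
  "fractional_poisson_process \<beta> M N \<longleftrightarrow>
     prob_space M \<and>
     (\<exists>T. prob_space.indep_vars M (\<lambda>_. borel) T {1..} \<and>
          (\<forall>j\<ge>1. AE \<omega> in M. 0 < T j \<omega>) \<and>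
          (\<forall>j\<ge>1. \<forall>t\<ge>0. measure M {\<omega> \<in> space M. t < T j \<omega>}
                              = mittag_leffler \<beta> (- (t powr \<beta>))) \<and>
          (\<forall>t\<ge>0. \<forall>\<omega>\<in>space M. N t \<omega> = Max {n. renewal_time T n \<omega> \<le> t}))"

definition cadlag :: "(real \<Rightarrow> real) \<Rightarrow> bool" where
  "cadlag f \<longleftrightarrow> (\<forall>x\<ge>0. (f \<longlongrightarrow> f x) (at_right x)) \<and> (\<forall>x>0. \<exists>l. (f \<longlongrightarrow> l) (at_left x))"

text \<open>
  Time runs over the nonnegative reals. Stochastic continuity follows from the stationarity
  of the increments and the path properties, so it is not listed separately.
\<close>

definition levy_process :: "'a measure \<Rightarrow> (real \<Rightarrow> 'a \<Rightarrow> real) \<Rightarrow> bool" where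
  "levy_process M S \<longleftrightarrow>
     prob_space M \<and>
     (\<forall>x\<ge>0. S x \<in> borel_measurable M) \<and>
     (AE \<omega> in M. S 0 \<omega> = 0) \<and>
     (AE \<omega> in M. cadlag (\<lambda>x. S x \<omega>)) \<and>
     (\<forall>(n::nat) (x::nat \<Rightarrow> real). 0 \<le> x 0 \<and> (\<forall>i<n. x i \<le> x (Suc i)) \<longrightarrow>
        prob_space.indep_vars M (\<lambda>_. borel) (\<lambda>i \<omega>. S (x (Suc i)) \<omega> - S (x i) \<omega>) {..<n}) \<and>
     (\<forall>x\<ge>0. \<forall>h\<ge>0. distr M borel (\<lambda>\<omega>. S (x + h) \<omega> - S x \<omega>) = distr M borel (S h))"

definition stable_subordinator :: "real \<Rightarrow> 'a measure \<Rightarrow> (real \<Rightarrow> 'a \<Rightarrow> real) \<Rightarrow> bool" where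
  "stable_subordinator \<beta> M S \<longleftrightarrow>
     levy_process M S \<and>
     (AE \<omega> in M. mono_on {0..} (\<lambda>x. S x \<omega>)) \<and>
     (\<forall>x\<ge>0. \<forall>s\<ge>0. prob_space.expectation M (\<lambda>\<omega>. exp (- s * S x \<omega>)) = exp (- x * s powr \<beta>))"

definition inverse_subordinator :: "(real \<Rightarrow> 'a \<Rightarrow> real) \<Rightarrow> real \<Rightarrow> 'a \<Rightarrow> real" where
  "inverse_subordinator S t \<omega> = Inf {x. 0 \<le> x \<and> t < S x \<omega>}"

text \<open>
  \<open>q x t\<close> is a density at \<open>x > 0\<close> of the inverse subordinator at time \<open>t > 0\<close>. The values of
  \<open>q\<close> at nonpositive \<open>x\<close> or \<open>t\<close> are irrelevant. Nonnegativity is required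
  explicitly because \<open>ennreal\<close> truncates negative values to 0.
\<close>

definition inverse_subordinator_density ::
    "'a measure \<Rightarrow> (real \<Rightarrow> 'a \<Rightarrow> real) \<Rightarrow> (real \<Rightarrow> real \<Rightarrow> real) \<Rightarrow> bool" where
  "inverse_subordinator_density M S q \<longleftrightarrow>
     (\<forall>t>0. (\<forall>x>0. 0 \<le> q x t) \<and>
        distributed M lborel (inverse_subordinator S t)
          (\<lambda>x. ennreal (indicator {0<..} x * q x t)))"

end

(* Let W(z) = sum_n (-z)^n / (n! Gamma(1 - beta n)), so that W' = -M_beta. Writing 1/Gamma(1 - a) = Gamma(a) sin(pi a) / pi
   and inserting the Gamma integral in the coordinate u = e^r turns W(x t^-beta) into an integral over the line Im w = pi, which
   Cauchy's theorem moves to a line Im w = phi with pi/2 < phi < min(pi, pi/(2 beta)), where everything converges absolutely.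
   There Fubini and a single residue at w = ln s give the Laplace transform e^{-x s^beta} / s of W(x t^-beta) in t. By uniqueness of
   Laplace transforms P(S x <= t) = W(x t^-beta), hence the inverse subordinator has density t^-beta M_beta(x t^-beta).
   The n-th renewal time has Laplace transform (1 + s^beta)^-n, which is also that of S at an independent Erlang time, so
   P(t_n <= t) = int x^{n-1} e^{-x} / (n-1)! W(x t^-beta) dx; integration by parts in the difference for n and n+1 gives the claim. *)

theory Submission
  imports Defs "HOL-Complex_Analysis.Complex_Analysis"
begin

text \<open>Each bound on the angle \<phi> has its own purpose. Above pi/2, cos \<phi> < 0, so exp
  (t e^w) decays along the line and s - e^w stays in the right half-plane. With \<beta> \<phi> <
  pi/2, e^(\<beta> w) has positive real part, so the other factor is at most x e^(\<beta> r) in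
  norm. Below pi, the strip between the line and its conjugate contains no zero of s - e^w except ln
  s. The line Im w = pi itself fails for \<beta> > 1/2: there the other factor grows like exp (x
  e^(\<beta> r) |cos (pi \<beta>)|), which exp (-t e^r) absorbs for fixed t, but not after
  integration over t. The sign of M_beta and the monotonicity of W are hidden in their power series.
  They are read off from the subordinator once W is known to describe its law. Transforms are
  compared at integers only, from a bound on, because the Mittag-Leffler series is integrated
  termwise only for s > 1. This yields equality almost everywhere, which right continuity extends to
  every t. The density q is an arbitrary version, so it is identified almost everywhere, which is
  enough under the integral.\<close>

section \<open>Uniqueness of Laplace transforms\<close>

text \<open>With y = exp (-x), the hypotheses say that a signed measure on [0, 1] has vanishing
  moments. Bounded support lets its characteristic function be expanded in these moments, and Levy
  uniqueness then applies to the normalized positive and negative parts.\<close>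

lemma laplace_transform_zero_imp_AE_zero:
  fixes h :: "real \<Rightarrow> real"
  assumes int: "integrable lborel h" and supp: "\<And>x. x \<le> 0 \<Longrightarrow> h x = 0"
    and zero: "\<And>k::nat. (LINT x|lborel. exp (- (real k * x)) * h x) = 0"
  shows "AE x in lborel. h x = 0"
proof -
  \<comment> \<open>Termwise integration of the exponential series: on the support exp (-x) is at
    most 1, so the k-th term is bounded by |h x| |u|^k / k!.\<close>
  have osc: "(LINT x|lborel. h x *\<^sub>R iexp (u * exp (-x))) = 0" for u
  proof -
    define f where "f k x = h x *\<^sub>R (((\<i> * (u * exp (-x))) ^ k) /\<^sub>R fact k)" for k x
    have f_alt: "f k x = (\<i> * u) ^ k / fact k * complex_of_real (exp (- (real k * x)) * h x)" for k x
    proof -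
      have "exp (- (real k * x)) = exp (- x) ^ k"
        by (simp flip: exp_of_nat_mult)
      then show ?thesis
        by (simp add: f_def scaleR_conv_of_real power_mult_distrib divide_inverse)
    qed
    have intk: "integrable lborel (\<lambda>x. exp (- (real k * x)) * h x)" for k
    proof (rule Bochner_Integration.integrable_bound [OF int])
      show "AE x in lborel. norm (exp (- (real k * x)) * h x) \<le> norm (h x)"
        proof (intro always_eventually allI)
        fix x
        show "norm (exp (- (real k * x)) * h x) \<le> norm (h x)"
          using supp [of x] by (cases "x \<le> 0") (auto simp: abs_mult mult_le_cancel_right1 mult_left_le_one_le)
      qed
    qed (use int in measurable)
    have intf: "integrable lborel (f k)" for k
      unfolding f_alt [abs_def] by (intro integrable_mult_right integrable_of_real intk)
    have "(LINT x|lborel. f k x) = 0" for k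
      unfolding f_alt using zero [of k] by (simp add: integral_complex_of_real del: of_real_mult)
    moreover have "norm (f k x) \<le> \<bar>h x\<bar> * (\<bar>u\<bar> ^ k / fact k)" for k x
    proof (cases "x \<le> 0")
      case False
      then have "exp (-x) ^ k \<le> 1"
        by (intro power_le_one) auto
      then have "\<bar>u\<bar> ^ k * exp (- x) ^ k \<le> \<bar>u\<bar> ^ k * 1"
        by (intro mult_left_mono) auto
      then show ?thesis
        by (auto simp: f_def norm_mult norm_power power_mult_distrib divide_simps mult_left_mono)
    qed (use supp in \<open>simp add: f_def\<close>)
    note bound = this
    have sm: "summable (\<lambda>k. \<bar>u\<bar> ^ k / fact k)"
      using summable_exp [of "\<bar>u\<bar>"] by (simp add: divide_inverse mult.commute)
    have "(LINT x|lborel. (\<Sum>k. f k x)) = (\<Sum>k. LINT x|lborel. f k x)"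
    proof (rule integral_suminf [OF intf])
      show "AE x in lborel. summable (\<lambda>i. norm (f i x))"
        by (intro always_eventually allI summable_comparison_test' [OF summable_mult [OF sm]])
          (use bound in auto)
      have le: "norm (LINT x|lborel. norm (f k x)) \<le> (LINT x|lborel. \<bar>h x\<bar>) * (\<bar>u\<bar> ^ k / fact k)" for k
      proof -
        have "(LINT x|lborel. norm (f k x)) \<le> (LINT x|lborel. \<bar>h x\<bar> * (\<bar>u\<bar> ^ k / fact k))"
          using int intf bound by (intro integral_mono) auto
        then show ?thesis using int by (simp add: integral_nonneg_AE)
      qed
      show "summable (\<lambda>i. LINT x|lborel. norm (f i x))"
        using le by (intro summable_comparison_test' [OF summable_mult [OF sm], where N=0]) auto
    qed
    moreover have "(\<Sum>k. f k x) = h x *\<^sub>R iexp (u * exp (-x))" for x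
    proof -
      have "(\<lambda>k. ((\<i> * (u * exp (-x))) ^ k) /\<^sub>R fact k) sums iexp (u * exp (-x))"
        using exp_converges [of "\<i> * (u * exp (-x))"] by simp
      from sums_scaleR_right [OF this, of "h x"] show ?thesis
        by (simp add: f_def sums_iff)
    qed
    ultimately show ?thesis by simp
  qed
  define p m where "p x = max (h x) 0" and "m x = max (- h x) 0" for x
  have h: "h x = p x - m x" for x by (simp add: p_def m_def)
  have [measurable]: "p \<in> borel_measurable borel" "m \<in> borel_measurable borel"
    using int by (auto simp: p_def [abs_def] m_def [abs_def])
  have ip: "integrable lborel p" and im: "integrable lborel m"
    unfolding p_def [abs_def] m_def [abs_def] using int by auto
  have nn: "p x \<ge> 0" "m x \<ge> 0" for x by (auto simp: p_def m_def)
  define c where "c = (LINT x|lborel. p x)"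
  \<comment> \<open>The hypothesis \<open>zero\<close> at k = 0 gives both parts the same mass, so
    one constant normalizes both.\<close>
  have c: "c = (LINT x|lborel. m x)"
    using zero [of 0] ip im by (simp add: h c_def)
  show ?thesis
  proof (cases "c = 0")
    case True
    then have "AE x in lborel. p x = 0" "AE x in lborel. m x = 0"
      using c c_def integral_nonneg_eq_0_iff_AE [OF ip] integral_nonneg_eq_0_iff_AE [OF im] nn by simp_all
    then show ?thesis by eventually_elim (simp add: h)
  next
    case False
    have "c \<ge> 0" using nn by (simp add: c_def integral_nonneg_AE)
    with False have cpos: "c > 0" by simp
    let ?D = "\<lambda>f. density lborel (\<lambda>x. ennreal (f x / c))"
    let ?E = "\<lambda>x::real. exp (-x)"
    have prob: "prob_space (?D f)" if f: "integrable lborel f" "\<And>x. f x \<ge> 0" "c = (LINT x|lborel. f x)"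
      for f :: "real \<Rightarrow> real"
    proof
      have "emeasure (?D f) (space (?D f)) = (\<integral>\<^sup>+x. ennreal (f x / c) \<partial>lborel)"
        using f by (subst emeasure_density) auto
      also have "\<dots> = ennreal (LINT x|lborel. f x / c)"
        using f cpos by (intro nn_integral_eq_integral) auto
      finally show "emeasure (?D f) (space (?D f)) = 1"
        using cpos by (simp add: f(3) [symmetric])
    qed
    have ch: "char (distr (?D f) borel ?E) u = (LINT x|lborel. f x *\<^sub>R iexp (u * exp (-x))) / c"
      if f: "integrable lborel f" "\<And>x. f x \<ge> 0" for f :: "real \<Rightarrow> real" and u
    proof -
      have "char (distr (?D f) borel ?E) u = (LINT x|lborel. (f x / c) *\<^sub>R iexp (u * exp (-x)))"
        unfolding char_def using f cpos
        by (subst integral_distr) (auto intro!: integral_density)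
      also have "\<dots> = (LINT x|lborel. (f x *\<^sub>R iexp (u * exp (-x))) / c)"
        by (simp add: scaleR_conv_of_real divide_simps)
      finally show ?thesis by simp
    qed
    have io: "integrable lborel (\<lambda>x. f x *\<^sub>R iexp (u * exp (-x)))" if "integrable lborel f"
      for f :: "real \<Rightarrow> real" and u
      by (rule Bochner_Integration.integrable_bound [OF that]) (use that in \<open>auto simp: norm_mult\<close>)
    have "char (distr (?D p) borel ?E) = char (distr (?D m) borel ?E)"
    proof
      fix u
      have "(LINT x|lborel. p x *\<^sub>R iexp (u * exp (-x))) - (LINT x|lborel. m x *\<^sub>R iexp (u * exp (-x)))
          = (LINT x|lborel. h x *\<^sub>R iexp (u * exp (-x)))"
        using io ip im by (subst Bochner_Integration.integral_diff [symmetric]) (auto simp: h scaleR_left_diff_distrib)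
      then show "char (distr (?D p) borel ?E) u = char (distr (?D m) borel ?E) u"
        using osc [of u] ip im nn by (simp add: ch)
    qed
    moreover have "real_distribution (distr (?D f) borel ?E)" if "prob_space (?D f)" for f
    proof -
      interpret prob_space "?D f" by fact
      show ?thesis by (rule real_distribution_distr) auto
    qed
    ultimately have "distr (?D p) borel ?E = distr (?D m) borel ?E"
      by (intro Levy_uniqueness) (use prob [OF ip nn(1) c_def] prob [OF im nn(2) c] in blast)+
    \<comment> \<open>The map exp (-x) is undone by -ln, so equal image laws mean equal
      laws.\<close>
    then have "distr (distr (?D p) borel ?E) borel (\<lambda>y. - ln y) = distr (distr (?D m) borel ?E) borel (\<lambda>y. - ln y)"
      by simp
    moreover have "distr (distr (?D f) borel ?E) borel (\<lambda>y. - ln y) = ?D f" for f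
      by (subst distr_distr) (auto simp: comp_def intro!: distr_id2)
    ultimately have "?D p = ?D m" by simp
    then have "AE x in lborel. ennreal (p x / c) = ennreal (m x / c)"
      by (intro sigma_finite_measure.density_unique [OF lborel.sigma_finite_measure_axioms]) auto
    then show ?thesis
      using nn cpos by (auto simp: h elim!: eventually_mono)
  qed
qed

text \<open>The parameter \<open>k0\<close> admits functions whose transforms are controlled only at
  larger arguments: the factor exp (-k0 x) is absorbed into the function, which shifts k by
  \<open>k0\<close>. Right continuity is what distribution functions offer for passing from almost
  every point to the point t.\<close>

lemma laplace_transform_unique_right_continuous:
  fixes g :: "real \<Rightarrow> real"
  assumes int: "\<And>k::nat. k \<ge> k0 \<Longrightarrow> integrable lborel (\<lambda>x. indicator {0<..} x * (exp (- (real k * x)) * g x))"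
    and zero: "\<And>k::nat. k \<ge> k0 \<Longrightarrow> (LINT x|lborel. indicator {0<..} x * (exp (- (real k * x)) * g x)) = 0"
    and cont: "continuous (at_right t) g" and t: "t > 0"
  shows "g t = 0"
proof (rule ccontr)
  assume neq: "g t \<noteq> 0"
  have "AE x in lborel. indicator {0<..} x * (exp (- (real k0 * x)) * g x) = 0"
  proof (rule laplace_transform_zero_imp_AE_zero [OF int])
    fix k :: nat
    have "(\<lambda>x. exp (- (real k * x)) * (indicator {0<..} x * (exp (- (real k0 * x)) * g x)))
       = (\<lambda>x. indicator {0<..} x * (exp (- (real (k + k0) * x)) * g x))"
    proof
      fix x :: real
      have "exp (- (real k * x)) * exp (- (real k0 * x)) = exp (- (real (k + k0) * x))"
        by (simp add: algebra_simps flip: exp_add)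
      then show "exp (- (real k * x)) * (indicator {0<..} x * (exp (- (real k0 * x)) * g x))
          = indicator {0<..} x * (exp (- (real (k + k0) * x)) * g x)"
        by (metis mult.assoc mult.left_commute)
    qed
    then show "(LINT x|lborel. exp (- (real k * x)) * (indicator {0<..} x * (exp (- (real k0 * x)) * g x))) = 0"
      using zero [of "k + k0"] by simp
  qed auto
  then have AE: "AE x in lborel. x > 0 \<longrightarrow> g x = 0"
    by eventually_elim (auto simp: indicator_def split: if_splits)
  have "(g \<longlongrightarrow> g t) (at_right t)"
    using cont by (simp add: continuous_within)
  then have "eventually (\<lambda>x. g x \<noteq> 0) (at_right t)"
    using neq by (rule tendsto_imp_eventually_ne)
  \<comment> \<open>If g t were nonzero, g would be nonzero on an interval of positive length to the
    right of t.\<close>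
  then obtain b where b: "b > t" "\<And>x. t < x \<Longrightarrow> x < b \<Longrightarrow> g x \<noteq> 0"
    unfolding eventually_at_right_field by auto
  have "AE x in lborel. x \<notin> {t<..<b}"
    using AE by eventually_elim (use b t in auto)
  then have "emeasure lborel {t<..<b} = 0"
    by (subst (asm) AE_iff_measurable [where N="{t<..<b}"]) auto
  then show False using b by simp
qed

section \<open>Gamma integrals and integrals over horizontal lines\<close>

text \<open>Euler's integral under u = t * exp r. In the coordinate r, rotating the ray of
  integration becomes shifting a horizontal line.\<close>

lemma has_bochner_integral_Gamma_log:
  fixes a t :: real
  assumes a: "a > 0" and t: "t > 0"
  shows "has_bochner_integral lborel (\<lambda>r. exp (a * r) * exp (- (t * exp r))) (Gamma a * t powr (- a))"
proof -
  let ?f = "\<lambda>u::real. u powr (a - 1) / exp u"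
  have "(?f has_integral Gamma a) {0..}"
    by (rule Gamma_integral_real [OF a])
  then have "(?f has_integral Gamma a) {0<..}"
    by (subst (asm) has_integral_spike_set_eq [where T="{0<..}"]) (auto intro: negligible_subset [of "{0}"])
  then have "?f absolutely_integrable_on {0<..}" "integral {0<..} ?f = Gamma a"
    by (auto simp: integral_unique intro!: nonnegative_absolutely_integrable_1 has_integral_integrable)
  moreover have img: "(\<lambda>r. t * exp r) ` UNIV = {0<..}"
  proof -
    have "x \<in> (\<lambda>r. t * exp r) ` UNIV" if "x > 0" for x
      using that t by (intro image_eqI [of _ _ "ln (x / t)"]) auto
    then show ?thesis using t by auto
  qed
  moreover have "(\<lambda>r. \<bar>t * exp r\<bar> *\<^sub>R ?f (t * exp r)) absolutely_integrable_on UNIV \<and>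
      integral UNIV (\<lambda>r. \<bar>t * exp r\<bar> *\<^sub>R ?f (t * exp r)) = Gamma a
      \<longleftrightarrow> ?f absolutely_integrable_on (\<lambda>r. t * exp r) ` UNIV \<and> integral ((\<lambda>r. t * exp r) ` UNIV) ?f = Gamma a"
    by (rule has_absolute_integral_change_of_variables_real)
      (use t in \<open>auto intro!: derivative_eq_intros inj_onI\<close>)
  ultimately have *: "(\<lambda>r. \<bar>t * exp r\<bar> *\<^sub>R ?f (t * exp r)) absolutely_integrable_on UNIV"
      "integral UNIV (\<lambda>r. \<bar>t * exp r\<bar> *\<^sub>R ?f (t * exp r)) = Gamma a"
    by auto
  have eq: "(\<lambda>r. \<bar>t * exp r\<bar> *\<^sub>R ?f (t * exp r)) = (\<lambda>r. t powr a * (exp (a * r) * exp (- (t * exp r))))"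
  proof
    fix r :: real
    have "t * exp r * (t * exp r) powr (a - 1) = (t * exp r) powr a"
      using t by (simp add: powr_mult_base)
    also have "\<dots> = t powr a * exp (a * r)"
      using t by (simp add: powr_def ln_mult exp_add algebra_simps)
    finally show "\<bar>t * exp r\<bar> *\<^sub>R ?f (t * exp r) = t powr a * (exp (a * r) * exp (- (t * exp r)))"
      using t by (simp add: exp_minus divide_inverse mult.assoc)
  qed
  have "integrable lborel (\<lambda>r. t powr a * (exp (a * r) * exp (- (t * exp r))))"
    using *(1) unfolding eq set_integrable_def by (subst (asm) integrable_completion) auto
  then have i: "integrable lborel (\<lambda>r. exp (a * r) * exp (- (t * exp r)))"
    using t by simp
  moreover have "t powr a * (LINT r|lborel. exp (a * r) * exp (- (t * exp r))) = Gamma a"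
    using *(2) unfolding eq using i by (subst (asm) integral_lborel) auto
  then have "(LINT r|lborel. exp (a * r) * exp (- (t * exp r))) = Gamma a * t powr (- a)"
    using t by (simp add: powr_minus field_simps)
  ultimately show ?thesis by (simp add: has_bochner_integral_iff)
qed

lemma contour_integral_horizontal:
  "p < q \<Longrightarrow> contour_integral (linepath (Complex p c) (Complex q c)) f = integral {p..q} (\<lambda>x. f (Complex x c))"
proof -
  assume "p < q"
  have "contour_integral (linepath (Complex p c) (Complex q c)) f
      = contour_integral (linepath (of_real p) (of_real q)) (\<lambda>x. f (x + \<i> * of_real c))"
    by (simp add: contour_integral_integral linepath_def Complex_eq algebra_simps scaleR_conv_of_real)
  also have "\<dots> = integral {p..q} (\<lambda>x. f (of_real x + \<i> * of_real c))"
    using \<open>p < q\<close> by (subst contour_integral_linepath_Reals_eq) auto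
  finally show ?thesis by (simp add: Complex_eq)
qed

lemma LINT_symmetric_interval_limit:
  fixes f :: "real \<Rightarrow> complex"
  assumes f: "integrable lborel f"
  shows "((\<lambda>R. integral {-R..R} f) \<longlongrightarrow> (LINT r|lborel. f r)) at_top"
proof -
  have eq: "integral {-R..R} f = (LINT r|lborel. indicator {-R..R} r *\<^sub>R f r)" for R
  proof -
    have "set_integrable lborel {-R..R} f"
      unfolding set_integrable_def using f by (intro integrable_mult_indicator) auto
    then show ?thesis
      by (simp add: set_borel_integral_eq_integral flip: set_lebesgue_integral_def)
  qed
  show ?thesis
    unfolding eq
  proof (rule integral_dominated_convergence_at_top [where w="\<lambda>r. norm (f r)"])
    have lim: "eventually (\<lambda>R. indicator {-R..R} r *\<^sub>R f r = f r) at_top" for r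
      using eventually_ge_at_top [of "\<bar>r\<bar>"] by eventually_elim (auto simp: indicator_def abs_le_iff)
    then show "AE r in lborel. ((\<lambda>R. indicator {-R..R} r *\<^sub>R f r) \<longlongrightarrow> f r) at_top"
      by (intro always_eventually allI tendsto_eventually lim)
  qed (use f in \<open>auto simp: indicator_def\<close>)
qed

text \<open>The two lines are closed to rectangles, whose vertical sides contribute at most (b - a)
  * (B R + B (-R)), and this tends to 0. The constant c will be 0 for an entire integrand and a
  residue term otherwise; \<rho> keeps the vertical sides clear of poles.\<close>

lemma horizontal_line_integrals_diff:
  fixes G :: "complex \<Rightarrow> complex" and a b :: real and B :: "real \<Rightarrow> real"
  assumes ab: "a < b"
    and rect: "\<And>R. R \<ge> \<rho> \<Longrightarrow> contour_integral (rectpath (Complex (-R) a) (Complex R b)) G = c"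
    and cont: "\<And>R. R \<ge> \<rho> \<Longrightarrow> continuous_on (path_image (rectpath (Complex (-R) a) (Complex R b))) G"
    and inta: "integrable lborel (\<lambda>r. G (Complex r a))"
    and intb: "integrable lborel (\<lambda>r. G (Complex r b))"
    and bound: "\<And>r y. \<bar>r\<bar> \<ge> \<rho> \<Longrightarrow> y \<in> {a..b} \<Longrightarrow> norm (G (Complex r y)) \<le> B r"
    and lim: "(B \<longlongrightarrow> 0) at_top" "(B \<longlongrightarrow> 0) at_bot"
  shows "(LINT r|lborel. G (Complex r a)) - (LINT r|lborel. G (Complex r b)) = c"
proof -
  let ?H = "\<lambda>y R. integral {-R..R} (\<lambda>r. G (Complex r y))"
  \<comment> \<open>This turns out to be the contribution of the two vertical sides.\<close>
  let ?E = "\<lambda>R. c - (?H a R - ?H b R)"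
  have est: "norm (?E R) \<le> (b - a) * (B R + B (-R))" if R: "R \<ge> \<rho>" "R > 0" for R
  proof -
    define a1 a2 a3 a4 where "a1 = Complex (-R) a" "a2 = Complex R a" "a3 = Complex R b" "a4 = Complex (-R) b"
    note defs = this
    have img: "path_image (rectpath a1 a3) =
           {z. Re z \<in> {-R, R} \<and> Im z \<in> {a..b}} \<union> {z. Im z \<in> {a, b} \<and> Re z \<in> {-R..R}}"
      using ab R by (subst path_image_rectpath) (auto simp: defs)
    have C: "continuous_on (path_image (rectpath a1 a3)) G"
      using cont [OF R(1)] by (simp add: defs)
    have ci: "G contour_integrable_on linepath a1 a2" "G contour_integrable_on linepath a2 a3"
      "G contour_integrable_on linepath a3 a4" "G contour_integrable_on linepath a4 a1"
      by (intro contour_integrable_continuous_linepath continuous_on_subset [OF C];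
          simp add: rectpath_def Let_def path_image_join defs; blast)+
    have "c = contour_integral (linepath a1 a2 +++ linepath a2 a3 +++ linepath a3 a4 +++ linepath a4 a1) G"
      using rect [OF R(1)] by (simp add: rectpath_def Let_def defs)
    also have "\<dots> = contour_integral (linepath a1 a2) G + (contour_integral (linepath a2 a3) G
        + (contour_integral (linepath a3 a4) G + contour_integral (linepath a4 a1) G))"
      using ci by (simp add: contour_integrable_joinI)
    also have "contour_integral (linepath a1 a2) G = ?H a R"
      unfolding defs using R by (intro contour_integral_horizontal) auto
    also have "contour_integral (linepath a3 a4) G = - contour_integral (linepath a4 a3) G"
      by (rule contour_integral_reversepath [of "linepath a4 a3", simplified])
    also have "contour_integral (linepath a4 a3) G = ?H b R"
      unfolding defs using R by (intro contour_integral_horizontal) auto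
    finally have "?E R = contour_integral (linepath a2 a3) G + contour_integral (linepath a4 a1) G"
      by simp
    also have "norm \<dots> \<le> B R * (b - a) + B (-R) * (b - a)"
    proof (rule norm_triangle_le, rule add_mono)
      have "norm (contour_integral (linepath a2 a3) G) \<le> B R * norm (a3 - a2)"
      proof (rule contour_integral_bound_linepath [OF ci(2)])
        show "0 \<le> B R" using bound [of R a] R ab by (intro order_trans [OF norm_ge_zero]) auto
        show "norm (G x) \<le> B R" if "x \<in> closed_segment a2 a3" for x
        proof -
          have "Re x = R" "Im x \<in> {a..b}"
            using that ab by (auto simp: defs closed_segment_same_Re closed_segment_eq_real_ivl)
          then show ?thesis
            using bound [of R "Im x"] R complex_surj [of x] by simp
        qed
      qed
      also have "norm (a3 - a2) = b - a" using ab by (simp add: defs cmod_def)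
      finally show "norm (contour_integral (linepath a2 a3) G) \<le> B R * (b - a)" .
      have "norm (contour_integral (linepath a4 a1) G) \<le> B (-R) * norm (a1 - a4)"
      proof (rule contour_integral_bound_linepath [OF ci(4)])
        show "0 \<le> B (-R)" using bound [of "-R" a] R ab by (intro order_trans [OF norm_ge_zero]) auto
        show "norm (G x) \<le> B (-R)" if "x \<in> closed_segment a4 a1" for x
        proof -
          have "Re x = -R" "Im x \<in> {a..b}"
            using that ab by (auto simp: defs closed_segment_same_Re closed_segment_eq_real_ivl)
          then show ?thesis
            using bound [of "-R" "Im x"] R complex_surj [of x] by simp
        qed
      qed
      also have "norm (a1 - a4) = b - a" using ab by (simp add: defs cmod_def)
      finally show "norm (contour_integral (linepath a4 a1) G) \<le> B (-R) * (b - a)" .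
    qed
    finally show ?thesis by (simp add: algebra_simps)
  qed
  have "((\<lambda>R. (b - a) * (B R + B (-R))) \<longlongrightarrow> (b - a) * (0 + 0)) at_top"
    using lim(1) filterlim_compose [OF lim(2) filterlim_uminus_at_bot_at_top]
    by (intro tendsto_intros) (auto simp: o_def)
  then have L: "((\<lambda>R. (b - a) * (B R + B (-R))) \<longlongrightarrow> 0) at_top"
    by simp
  have ev: "eventually (\<lambda>R. norm (?E R) \<le> (b - a) * (B R + B (-R))) at_top"
    using eventually_ge_at_top [of "max \<rho> 1"] by (rule eventually_mono) (use est in simp)
  have "(?E \<longlongrightarrow> 0) at_top"
    by (rule Lim_null_comparison [OF ev L])
  moreover have "(?E \<longlongrightarrow> c - ((LINT r|lborel. G (Complex r a)) - (LINT r|lborel. G (Complex r b)))) at_top"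
    using inta intb by (intro tendsto_intros LINT_symmetric_interval_limit)
  ultimately have "0 = c - ((LINT r|lborel. G (Complex r a)) - (LINT r|lborel. G (Complex r b)))"
    by (intro tendsto_unique) auto
  then show ?thesis by simp
qed

lemma has_bochner_integral_powr_exp:
  fixes a b :: real
  assumes a: "a > 0" and b: "b > 0"
  shows "has_bochner_integral lborel (\<lambda>u. indicator {0<..} u * (u powr (a - 1) * exp (- (b * u)))) (Gamma a * b powr (- a))"
proof -
  let ?f = "\<lambda>u::real. indicator {0<..} u * (u powr (a - 1) * exp (- u))"
  have "((\<lambda>u. u powr (a - 1) / exp u) has_integral Gamma a) {0..}"
    by (rule Gamma_integral_real [OF a])
  then have "((\<lambda>u. u powr (a - 1) / exp u) has_integral Gamma a) {0<..}"
    by (subst (asm) has_integral_spike_set_eq [where T="{0<..}"]) (auto intro: negligible_subset [of "{0}"])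
  from nn_integral_has_integral_lebesgue [OF _ this]
  have "(\<integral>\<^sup>+u. ennreal (?f u) \<partial>lborel) = ennreal (Gamma a)"
    by (simp add: exp_minus divide_inverse)
  then have "has_bochner_integral lborel ?f (Gamma a)"
    using a by (intro has_bochner_integral_nn_integral) (auto intro: Gamma_real_nonneg)
  then have "has_bochner_integral lborel (\<lambda>u. ?f (0 + b * u)) (Gamma a /\<^sub>R \<bar>b\<bar>)"
    using b by (subst lborel_has_bochner_integral_real_affine_iff [symmetric]) auto
  also have "(\<lambda>u. ?f (0 + b * u)) = (\<lambda>u. b powr (a - 1) * (indicator {0<..} u * (u powr (a - 1) * exp (- (b * u)))))"
    using b by (auto simp: fun_eq_iff indicator_def powr_mult zero_less_mult_iff)
  finally have "has_bochner_integral lborel (\<lambda>u. b powr (1 - a) * (b powr (a - 1) * (indicator {0<..} u * (u powr (a - 1) * exp (- (b * u)))))) (b powr (1 - a) * (Gamma a /\<^sub>R \<bar>b\<bar>))"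
    by (rule has_bochner_integral_mult_right)
  moreover have "b powr (1 - a) * (Gamma a /\<^sub>R \<bar>b\<bar>) = Gamma a * b powr (- a)"
    using b by (simp add: powr_diff powr_minus field_simps)
  moreover have "b powr (1 - a) * (b powr (a - 1) * y) = y" for y
    using b by (simp add: powr_add [symmetric] flip: mult.assoc)
  ultimately show ?thesis by (simp only:)
qed

lemma has_bochner_integral_power_exp:
  fixes b :: real
  assumes b: "b > 0"
  shows "has_bochner_integral lborel (\<lambda>u. indicator {0<..} u * (u ^ k * exp (- (b * u)))) (fact k / b ^ Suc k)"
proof -
  have "has_bochner_integral lborel (\<lambda>u. indicator {0<..} u * (u powr (real (Suc k) - 1) * exp (- (b * u)))) (Gamma (real (Suc k)) * b powr (- real (Suc k)))"
    using b by (intro has_bochner_integral_powr_exp) auto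
  also have "(\<lambda>u. indicator {0<..} u * (u powr (real (Suc k) - 1) * exp (- (b * u))))
     = (\<lambda>u. indicator {0<..} u * (u ^ k * exp (- (b * u))))"
    by (auto simp: fun_eq_iff indicator_def powr_realpow)
  also have "Gamma (real (Suc k)) * b powr (- real (Suc k)) = fact k / b ^ Suc k"
    using b Gamma_fact [of k, where 'a=real] by (simp only: powr_minus powr_realpow) (simp add: add.commute divide_inverse)
  finally show ?thesis .
qed

lemma has_bochner_integral_exp_complex:
  fixes c :: complex
  assumes c: "Re c > 0"
  shows "has_bochner_integral lborel (\<lambda>t. indicator {0<..} t *\<^sub>R exp (- c * of_real t)) (1 / c)"
proof -
  have nr: "norm (indicator {0<..} t *\<^sub>R exp (- c * of_real t)) = indicator {0<..} t * exp (- (Re c * t))" for t :: real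
    by (simp add: norm_exp_eq_Re)
  have "integrable lborel (\<lambda>t. indicator {0<..} t * exp (- (Re c * t)))"
    using has_bochner_integral_power_exp [OF c, of 0] by (simp add: has_bochner_integral_iff)
  then have int: "integrable lborel (\<lambda>t. indicator {0<..} t *\<^sub>R exp (- c * of_real t))"
    by (rule Bochner_Integration.integrable_bound) (auto simp: nr)
  have "(LBINT t=ereal 0..\<infinity>. exp (- c * of_real t)) = 0 - (- 1 / c)"
  proof (rule interval_integral_FTC_integrable [where F="\<lambda>t. - exp (- c * of_real t) / c"])
    show "((\<lambda>t. - exp (- c * of_real t) / c) has_vector_derivative exp (- c * of_real x)) (at x)" for x :: real
    proof -
      have "((\<lambda>z. - exp (- c * z) / c) has_field_derivative exp (- c * of_real x)) (at (of_real x))"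
        using c by (auto intro!: derivative_eq_intros)
      from has_vector_derivative_real_field [OF this] show ?thesis .
    qed
    show "set_integrable lborel (einterval (ereal 0) \<infinity>) (\<lambda>t. exp (- c * of_real t))"
      using int by (simp add: set_integrable_def)
    have "isCont (\<lambda>t. - exp (- c * of_real t) / c) (0::real)"
      using c by (intro continuous_intros) auto
    then have "((\<lambda>t. - exp (- c * of_real t) / c) \<longlongrightarrow> - 1 / c) (at_right (0::real))"
      by (auto simp: isCont_def intro: filterlim_at_split [THEN iffD1, THEN conjunct2])
    then show "(((\<lambda>t. - exp (- c * of_real t) / c) \<circ> real_of_ereal) \<longlongrightarrow> - 1 / c) (at_right (ereal 0))"
      by (simp add: ereal_tendsto_simps)
    define a where "a = Re c"
    have "((\<lambda>t. exp (- (a * t))) \<longlongrightarrow> 0) at_top"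
      using c unfolding a_def [symmetric] by real_asymp
    then have "((\<lambda>t. exp (- (Re c * t)) / norm c) \<longlongrightarrow> 0) at_top"
      unfolding a_def by (rule tendsto_divide_zero)
    then have "((\<lambda>t. - exp (- c * of_real t) / c) \<longlongrightarrow> 0) at_top"
      by (rule Lim_null_comparison [rotated]) (auto simp: norm_divide norm_exp_eq_Re)
    then show "(((\<lambda>t. - exp (- c * of_real t) / c) \<circ> real_of_ereal) \<longlongrightarrow> 0) (at_left \<infinity>)"
      by (simp add: ereal_tendsto_simps)
  qed auto
  then have "(LINT t|lborel. indicator {0<..} t *\<^sub>R exp (- c * of_real t)) = 1 / c"
    by (simp add: interval_integral_to_infinity_eq set_lebesgue_integral_def)
  with int show ?thesis by (simp add: has_bochner_integral_iff)
qed

section \<open>Estimates for the exponential and the reflection formula\<close>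

lemma norm_exp_minus_1_le:
  fixes u :: complex
  assumes "Re u \<ge> 0"
  shows "norm (exp (- u) - 1) \<le> norm u"
proof -
  have "norm (exp (- u) - exp 0) \<le> 1 * norm (- u - 0)"
  proof (rule field_differentiable_bound [where S="{z. Re z \<le> 0}" and f=exp and f'=exp])
    show "convex {z. Re z \<le> 0}" by (rule convex_halfspace_Re_le)
  qed (use assms in \<open>auto intro!: derivative_eq_intros simp: norm_exp_eq_Re\<close>)
  then show ?thesis by simp
qed

text \<open>The mean value inequality on a ball, without a sign condition on Re u. It serves the
  lines between \<phi> and pi, where exp (\<beta> w) may leave the right half-plane.\<close>

lemma norm_exp_minus_1_le_exp:
  fixes u :: complex
  shows "norm (exp (- u) - 1) \<le> norm u * exp (norm u)"
proof -
  have "norm (exp (- u) - exp 0) \<le> exp (norm u) * norm (- u - 0)"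
  proof (rule field_differentiable_bound [where S="cball 0 (norm u)" and f=exp and f'=exp])
    show "norm (exp z) \<le> exp (norm u)" if "z \<in> cball 0 (norm u)" for z :: complex
      using that complex_Re_le_cmod [of z] by (simp add: norm_exp_eq_Re)
  qed (auto intro!: derivative_eq_intros)
  then show ?thesis by (simp add: mult.commute)
qed

text \<open>As \<beta> < 1, exp (\<beta> r) is eventually negligible against exp r. Before the
  crossover \<open>r0\<close> the left side is bounded by its value at \<open>r0\<close>.\<close>

lemma exp_power_dominated:
  fixes \<beta> x t :: real
  assumes "0 < \<beta>" "\<beta> < 1" "x \<ge> 0" "t > 0"
  obtains C where "\<And>r. x * exp (\<beta> * r) \<le> t * exp r + C"
proof
  fix r :: real
  \<comment> \<open>Solves exp ((1 - \<beta>) r0) = x / t + 1; the summand 1 keeps the argument of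
    ln positive when x = 0.\<close>
  define r0 where "r0 = ln (x / t + 1) / (1 - \<beta>)"
  show "x * exp (\<beta> * r) \<le> t * exp r + x * exp (\<beta> * r0)"
  proof (cases "r \<ge> r0")
    case True
    have "x / t + 1 > 0" using assms by (simp add: add_nonneg_pos)
    then have "x / t \<le> exp ((1 - \<beta>) * r0)" using assms by (simp add: r0_def)
    also have "\<dots> \<le> exp ((1 - \<beta>) * r)" using True assms by simp
    finally have "x \<le> t * exp ((1 - \<beta>) * r)" using assms by (simp add: field_simps)
    then have "x * exp (\<beta> * r) \<le> t * exp ((1 - \<beta>) * r) * exp (\<beta> * r)"
      by (intro mult_right_mono) auto
    also have "\<dots> = t * exp r" by (simp add: algebra_simps flip: exp_add)
    finally show ?thesis using assms by (simp add: add_increasing2)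
  next
    case False
    then have "x * exp (\<beta> * r) \<le> x * exp (\<beta> * r0)" using assms by (intro mult_left_mono) auto
    then show ?thesis using assms by (simp add: add_increasing)
  qed
qed

text \<open>With \<open>rGamma\<close> the formula includes positive integers a, where Gamma (1 - a)
  has a pole and both sides are 0. Such a occur among the \<beta> n when \<beta> is
  rational.\<close>

lemma rGamma_reflection_real:
  fixes a :: real
  assumes "a > 0"
  shows "rGamma (1 - a) = Gamma a * sin (pi * a) / pi"
proof -
  have "complex_of_real (rGamma a * rGamma (1 - a)) = complex_of_real (sin (pi * a) / pi)"
    using rGamma_reflection_complex [of "of_real a"]
    by (metis of_real_1 of_real_diff of_real_divide of_real_mult rGamma_complex_of_real sin_of_real)
  then have "rGamma a * rGamma (1 - a) = sin (pi * a) / pi"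
    by (simp only: of_real_eq_iff)
  moreover have "rGamma a = 1 / Gamma a" by (simp add: Gamma_def divide_inverse)
  moreover have "Gamma a > 0" using assms by (rule Gamma_real_pos)
  ultimately show ?thesis by (simp add: field_simps)
qed

section \<open>The survival function of the inverse subordinator\<close>

text \<open>The Wright function with parameters -\<beta> and 1 at the point -z. The name anticipates
  that its value at x t^(-\<beta>) is P (S x \<le> t), the probability that the inverse subordinator
  at time t exceeds x.\<close>

definition wright_survival :: "real \<Rightarrow> real \<Rightarrow> real" where
  "wright_survival \<beta> z = (\<Sum>n. (- z) ^ n / fact n * rGamma (1 - \<beta> * real n))"

text \<open>Half of t pays for the growth of exp (x exp (\<beta> r)), and the other half remains in
  an integrable envelope. The factor exp (\<beta> r) is kept because it supplies the decay at r ->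
  -infinity.\<close>

lemma exp_exp_dominated:
  fixes \<beta> x t :: real
  assumes \<beta>: "0 < \<beta>" "\<beta> < 1" and x: "x \<ge> 0" and t: "t > 0"
  obtains C where "C \<ge> 0"
    and "\<And>r. x * exp (\<beta> * r) * exp (x * exp (\<beta> * r)) * exp (- (t * exp r)) \<le> C * (exp (\<beta> * r) * exp (- (t / 2 * exp r)))"
proof -
  obtain C where C: "\<And>r. x * exp (\<beta> * r) \<le> t / 2 * exp r + C"
    using exp_power_dominated [of \<beta> x "t / 2"] assms by auto
  show thesis
  proof
    fix r :: real
    have "exp (x * exp (\<beta> * r)) \<le> exp (t / 2 * exp r + C)"
      using C by simp
    then have "x * exp (\<beta> * r) * exp (x * exp (\<beta> * r)) * exp (- (t * exp r))
      \<le> x * exp (\<beta> * r) * exp (t / 2 * exp r + C) * exp (- (t * exp r))"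
      using x by (intro mult_right_mono mult_left_mono) auto
    also have "exp (t / 2 * exp r + C) * exp (- (t * exp r)) = exp C * exp (- (t / 2 * exp r))"
      by (simp add: field_simps flip: exp_add)
    then have "x * exp (\<beta> * r) * exp (t / 2 * exp r + C) * exp (- (t * exp r))
      = (x * exp C) * (exp (\<beta> * r) * exp (- (t / 2 * exp r)))"
      by (simp only: mult_ac)
    finally show "x * exp (\<beta> * r) * exp (x * exp (\<beta> * r)) * exp (- (t * exp r)) \<le> x * exp C * (exp (\<beta> * r) * exp (- (t / 2 * exp r)))" .
  qed (use x in auto)
qed

lemma exp_minus_1_sums:
  fixes z :: "'a :: {real_normed_field, banach}"
  shows "(\<lambda>n. z ^ Suc n / fact (Suc n)) sums (exp z - 1)"
proof -
  have "(\<lambda>n. z ^ n / fact n) sums exp z"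
    using exp_converges [of z] by (simp add: scaleR_conv_of_real divide_inverse mult.commute)
  then show ?thesis
    by (subst sums_Suc_iff) simp
qed

section \<open>Convergence of the Wright series and its integral over the line Im w = pi\<close>

context
  fixes \<beta> :: real
  assumes \<beta>: "0 < \<beta>" "\<beta> < 1"
begin

text \<open>Inserting the Gamma integral makes the partial sums integrals of partial sums of exp y -
  1 with y = x exp (\<beta> r), weighted by exp (-t exp r). All of them lie below one integrable
  envelope.\<close>

lemma summable_Gamma_power_div_fact:
  fixes x t :: real
  assumes x: "x \<ge> 0" and t: "t > 0"
  shows "summable (\<lambda>n. x ^ Suc n / fact (Suc n) * (Gamma (\<beta> * real (Suc n)) * t powr (- (\<beta> * real (Suc n)))))"
proof -
  obtain C where C: "C \<ge> 0"
    "\<And>r. x * exp (\<beta> * r) * exp (x * exp (\<beta> * r)) * exp (- (t * exp r)) \<le> C * (exp (\<beta> * r) * exp (- (t / 2 * exp r)))"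
    using exp_exp_dominated [OF \<beta> x t] by blast
  let ?f = "\<lambda>n r. x ^ Suc n / fact (Suc n) * (exp (\<beta> * real (Suc n) * r) * exp (- (t * exp r)))"
  let ?D = "\<lambda>r. C * (exp (\<beta> * r) * exp (- (t / 2 * exp r)))"
  have intD: "integrable lborel ?D"
    using has_bochner_integral_Gamma_log [of \<beta> "t / 2"] \<beta> t
    by (intro integrable_mult_right) (auto simp: has_bochner_integral_iff)
  have f: "has_bochner_integral lborel (?f n) (x ^ Suc n / fact (Suc n) * (Gamma (\<beta> * real (Suc n)) * t powr (- (\<beta> * real (Suc n)))))" for n
    by (intro has_bochner_integral_mult_right has_bochner_integral_Gamma_log) (use \<beta> t in auto)
  show ?thesis
  proof (rule summableI_nonneg_bounded)
    show "0 \<le> x ^ Suc n / fact (Suc n) * (Gamma (\<beta> * real (Suc n)) * t powr (- (\<beta> * real (Suc n))))" for n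
      using x \<beta> by (intro mult_nonneg_nonneg divide_nonneg_nonneg Gamma_real_nonneg) auto
    fix N
    have "(\<Sum>n<N. x ^ Suc n / fact (Suc n) * (Gamma (\<beta> * real (Suc n)) * t powr (- (\<beta> * real (Suc n)))))
        = (LINT r|lborel. (\<Sum>n<N. ?f n r))"
      using f by (subst Bochner_Integration.integral_sum) (simp_all only: has_bochner_integral_iff)
    also have "\<dots> \<le> (LINT r|lborel. ?D r)"
    proof (rule integral_mono [OF _ intD])
      show "integrable lborel (\<lambda>r. \<Sum>n<N. ?f n r)"
        using f by (intro Bochner_Integration.integrable_sum) (auto simp: has_bochner_integral_iff)
      fix r :: real
      have pw: "x ^ Suc n / fact (Suc n) * (exp (\<beta> * real (Suc n) * r) * exp (- (t * exp r)))
          = (x * exp (\<beta> * r)) ^ Suc n / fact (Suc n) * exp (- (t * exp r))" for n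
      proof -
        have "exp (\<beta> * real (Suc n) * r) = exp (\<beta> * r) ^ Suc n"
          by (simp add: mult_ac flip: exp_of_nat_mult del: of_nat_Suc power_Suc)
        then show ?thesis by (simp only: power_mult_distrib) (simp add: divide_inverse mult_ac)
      qed
      let ?y = "x * exp (\<beta> * r)"
      have y: "?y \<ge> 0" using x by simp
      have "(\<Sum>n<N. ?f n r) = (\<Sum>n<N. ?y ^ Suc n / fact (Suc n)) * exp (- (t * exp r))"
        unfolding pw sum_distrib_right ..
      also have "(\<Sum>n<N. ?y ^ Suc n / fact (Suc n)) \<le> exp ?y - 1"
        using exp_minus_1_sums [of ?y] y by (subst sums_unique [OF exp_minus_1_sums], intro sum_le_suminf)
          (auto simp: sums_iff simp del: power_Suc fact_Suc)
      \<comment> \<open>This comes from 1 - y \<le> exp (-y). The factor y is what gives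
        integrability at r -> -infinity, where exp (-t exp r) tends to 1.\<close>
      also have "exp ?y - 1 \<le> ?y * exp ?y"
      proof -
        have "(1 - ?y) * exp ?y \<le> exp (- ?y) * exp ?y"
          using exp_ge_add_one_self [of "- ?y"] by (intro mult_right_mono) auto
        then show ?thesis by (simp add: algebra_simps flip: exp_add)
      qed
      finally have "(\<Sum>n<N. ?f n r) \<le> ?y * exp ?y * exp (- (t * exp r))"
        by simp
      also note C(2)
      finally show "(\<Sum>n<N. ?f n r) \<le> ?D r" .
    qed
    finally show "(\<Sum>n<N. x ^ Suc n / fact (Suc n) * (Gamma (\<beta> * real (Suc n)) * t powr (- (\<beta> * real (Suc n))))) \<le> (LINT r|lborel. ?D r)" .
  qed
qed

text \<open>The reflection formula bounds |rGamma (1 - a)| by Gamma a, since |sin| / pi \<le> 1. The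
  term n = 0 is split off because there a = 0 is a pole of Gamma.\<close>

lemma summable_wright_survival: "summable (\<lambda>n. (- z) ^ n / fact n * rGamma (1 - \<beta> * real n))"
proof -
  have "summable (\<lambda>n. (- z) ^ Suc n / fact (Suc n) * rGamma (1 - \<beta> * real (Suc n)))"
  proof (rule summable_comparison_test')
    show "summable (\<lambda>n. \<bar>z\<bar> ^ Suc n / fact (Suc n) * Gamma (\<beta> * real (Suc n)))"
      using summable_Gamma_power_div_fact [of "\<bar>z\<bar>" 1] by (simp del: power_Suc fact_Suc)
    fix n :: nat
    let ?a = "\<beta> * real (Suc n)"
    have a: "?a > 0" using \<beta> by simp
    have "\<bar>sin (pi * ?a)\<bar> / pi \<le> 1"
      using pi_ge_two abs_sin_le_one [of "pi * ?a"] by (simp add: field_simps del: abs_sin_le_one)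
    then have "\<bar>rGamma (1 - ?a)\<bar> \<le> Gamma ?a * 1"
      using Gamma_real_pos [OF a] unfolding rGamma_reflection_real [OF a]
      by (simp add: abs_mult mult_left_le flip: times_divide_eq_right del: of_nat_Suc)
    then show "norm ((- z) ^ Suc n / fact (Suc n) * rGamma (1 - ?a)) \<le> \<bar>z\<bar> ^ Suc n / fact (Suc n) * Gamma ?a"
      by (simp add: abs_mult mult_left_mono divide_right_mono power_abs del: power_Suc fact_Suc of_nat_Suc)
  qed
  then show ?thesis by (subst (asm) summable_Suc_iff)
qed

text \<open>Termwise differentiation moves n to n + 1, which turns 1 - \<beta> n into the argument
  -\<beta> n + 1 - \<beta> of \<open>M_Wright\<close> and leaves one sign over.\<close>

lemma wright_survival_has_derivative:
  "(wright_survival \<beta> has_field_derivative - M_Wright \<beta> z) (at z)"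
proof -
  define c where "c n = (- 1) ^ n / fact n * rGamma (1 - \<beta> * real n)" for n
  have pw: "c n * z ^ n = (- z) ^ n / fact n * rGamma (1 - \<beta> * real n)" for n z
    by (subst power_minus) (simp add: c_def)
  have "((\<lambda>z. \<Sum>n. c n * z ^ n) has_field_derivative (\<Sum>n. diffs c n * z ^ n)) (at z)"
    by (rule termdiffs_strong_converges_everywhere) (use summable_wright_survival in \<open>simp add: pw\<close>)
  also have "(\<lambda>z. \<Sum>n. c n * z ^ n) = wright_survival \<beta>"
    by (simp add: wright_survival_def fun_eq_iff pw)
  also have "(\<Sum>n. diffs c n * z ^ n) = - M_Wright \<beta> z"
  proof -
    have "diffs c n * z ^ n = - ((- z) ^ n / fact n * rGamma (- \<beta> * real n + 1 - \<beta>))" for n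
    proof -
      have "1 - \<beta> * real (Suc n) = - \<beta> * real n + 1 - \<beta>" by (simp add: algebra_simps)
      then have "diffs c n = - ((- 1) ^ n / fact n * rGamma (- \<beta> * real n + 1 - \<beta>))"
        unfolding diffs_def c_def by (simp only: fact_Suc power_Suc) (simp add: field_simps del: of_nat_Suc)
      then show ?thesis by (subst power_minus) simp
    qed
    moreover have "summable (\<lambda>n. diffs c n * z ^ n)"
      by (rule termdiff_converges_all) (use summable_wright_survival in \<open>simp add: pw\<close>)
    ultimately show ?thesis
      unfolding M_Wright_def by (simp add: suminf_minus summable_minus_iff)
  qed
  finally show ?thesis .
qed

text \<open>Up to sign the coefficients are those of a differentiated power series, and convergence
  everywhere is inherited.\<close>

lemma isCont_M_Wright: "isCont (M_Wright \<beta>) z"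
proof -
  define c where "c n = (- 1) ^ n / fact n * rGamma (1 - \<beta> * real n)" for n
  define d where "d n = (- 1) ^ n / fact n * rGamma (- \<beta> * real n + 1 - \<beta>)" for n
  have "summable (\<lambda>n. c n * z ^ n)" for z
    using summable_wright_survival [of z] by (subst (asm) power_minus) (simp add: c_def mult_ac)
  then have "summable (\<lambda>n. diffs c n * z ^ n)" for z
    by (rule termdiff_converges_all)
  moreover have "diffs c n = - d n" for n
  proof -
    have "1 - \<beta> * real (Suc n) = - \<beta> * real n + 1 - \<beta>" by (simp add: algebra_simps)
    then show ?thesis
      unfolding diffs_def c_def d_def by (simp only: fact_Suc power_Suc) (simp add: field_simps del: of_nat_Suc)
  qed
  ultimately have "summable (\<lambda>n. d n * z ^ n)" for z
    by (simp add: summable_minus_iff)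
  then have "isCont (\<lambda>z. \<Sum>n. d n * z ^ n) z"
    by (rule isCont_powser_converges_everywhere)
  also have "(\<lambda>z. \<Sum>n. d n * z ^ n) = M_Wright \<beta>"
    unfolding M_Wright_def by (subst power_minus) (simp add: d_def fun_eq_iff mult_ac)
  finally show ?thesis .
qed

text \<open>The sine in the reflection formula is the imaginary part of a power of exp (i pi
  \<beta>), so the terms with n \<ge> 1 sum to an exponential series under the integral. The term n
  = 0 has no Gamma integral: it is the leading 1, and its absence from the series is the -1 in the
  integrand.\<close>

lemma wright_survival_log_integral:
  fixes x t :: real
  assumes x: "x \<ge> 0" and t: "t > 0"
  shows "wright_survival \<beta> (x * t powr (- \<beta>))
     = 1 + Im (LINT r|lborel. exp (- of_real (t * exp r)) * (exp (- (of_real (x * exp (\<beta> * r)) * exp (\<i> * of_real (pi * \<beta>)))) - 1)) / pi"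
proof -
  define \<kappa> where "\<kappa> = exp (\<i> * complex_of_real (pi * \<beta>))"
  define f where "f n r = (- (of_real x * \<kappa>)) ^ Suc n / fact (Suc n) * of_real (exp (\<beta> * real (Suc n) * r) * exp (- (t * exp r)))"
    for n and r :: real
  let ?I = "\<lambda>n. Gamma (\<beta> * real (Suc n)) * t powr (- (\<beta> * real (Suc n)))"
  have nk: "norm \<kappa> = 1" unfolding \<kappa>_def by (simp del: of_real_mult)
  have gi: "has_bochner_integral lborel (\<lambda>r. exp (\<beta> * real (Suc n) * r) * exp (- (t * exp r))) (?I n)" for n
    by (rule has_bochner_integral_Gamma_log) (use \<beta> t in auto)
  have f: "has_bochner_integral lborel (f n) ((- (of_real x * \<kappa>)) ^ Suc n / fact (Suc n) * of_real (?I n))" for n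
    unfolding f_def [abs_def] by (intro has_bochner_integral_mult_right has_bochner_integral_of_real gi)
  have nf: "norm (f n r) = x ^ Suc n / fact (Suc n) * (exp (\<beta> * real (Suc n) * r) * exp (- (t * exp r)))" for n r
    using x by (simp only: f_def norm_mult norm_divide norm_power norm_minus_cancel nk norm_of_real norm_fact) simp
  have fs: "f n r = exp (- of_real (t * exp r)) * ((- (of_real (x * exp (\<beta> * r)) * \<kappa>)) ^ Suc n / fact (Suc n))" for n r
  proof -
    have "exp (\<beta> * real (Suc n) * r) = exp (\<beta> * r) ^ Suc n"
      by (simp add: mult_ac flip: exp_of_nat_mult del: of_nat_Suc power_Suc)
    moreover have "- (of_real (x * exp (\<beta> * r)) * \<kappa>) = (- (of_real x * \<kappa>)) * of_real (exp (\<beta> * r))"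
      by simp
    ultimately show ?thesis
      unfolding f_def by (simp only: power_mult_distrib of_real_mult of_real_power exp_of_real [symmetric] of_real_minus) 
         (simp add: divide_inverse mult_ac)
  qed
  have sums: "(\<lambda>n. f n r) sums (exp (- of_real (t * exp r)) * (exp (- (of_real (x * exp (\<beta> * r)) * \<kappa>)) - 1))" for r
    unfolding fs by (intro sums_mult exp_minus_1_sums)
  \<comment> \<open>Since \<kappa> has norm 1, the integrals of the norms are the terms of
    \<open>summable_Gamma_power_div_fact\<close>.\<close>
  have "(\<lambda>n. LINT r|lborel. f n r) sums (LINT r|lborel. (\<Sum>n. f n r))"
  proof (rule sums_integral)
    show "integrable lborel (f n)" for n using f by (simp add: has_bochner_integral_iff)
    show "AE r in lborel. summable (\<lambda>n. norm (f n r))"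
    proof (intro always_eventually allI)
      fix r :: real
      have "(\<lambda>n. exp (- (t * exp r)) * ((x * exp (\<beta> * r)) ^ Suc n / fact (Suc n))) sums (exp (- (t * exp r)) * (exp (x * exp (\<beta> * r)) - 1))"
        by (intro sums_mult exp_minus_1_sums)
      moreover have "norm (f n r) = exp (- (t * exp r)) * ((x * exp (\<beta> * r)) ^ Suc n / fact (Suc n))" for n
        using x by (simp only: fs norm_mult norm_divide norm_power norm_minus_cancel nk norm_of_real norm_fact norm_exp_eq_Re) simp
      ultimately show "summable (\<lambda>n. norm (f n r))"
        by (simp only: sums_iff)
    qed
    have "(LINT r|lborel. norm (f n r)) = x ^ Suc n / fact (Suc n) * ?I n" for n
      unfolding nf using has_bochner_integral_mult_right [OF gi] by (simp only: has_bochner_integral_iff)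
    then show "summable (\<lambda>n. LINT r|lborel. norm (f n r))"
      using summable_Gamma_power_div_fact [OF x t] by (simp only:)
  qed
  then have S: "(\<lambda>n. Im (LINT r|lborel. f n r)) sums Im (LINT r|lborel. exp (- of_real (t * exp r)) * (exp (- (of_real (x * exp (\<beta> * r)) * \<kappa>)) - 1))"
    using sums by (intro sums_Im) (simp add: sums_iff)
  have im: "Im (LINT r|lborel. f n r) / pi
      = (- (x * t powr (- \<beta>))) ^ Suc n / fact (Suc n) * rGamma (1 - \<beta> * real (Suc n))" for n
  proof -
    let ?a = "\<beta> * real (Suc n)"
    have "\<kappa> ^ Suc n = cis (pi * ?a)"
      unfolding \<kappa>_def by (simp add: cis_conv_exp exp_of_nat_mult [symmetric] mult_ac del: power_Suc of_nat_Suc)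
    then have "(- (of_real x * \<kappa>)) ^ Suc n = of_real ((- x) ^ Suc n) * cis (pi * ?a)"
      by (metis mult_minus_left of_real_minus of_real_power power_mult_distrib)
    then have "(LINT r|lborel. f n r) = of_real ((- x) ^ Suc n / fact (Suc n) * ?I n) * cis (pi * ?a)"
      using f [of n] by (simp add: has_bochner_integral_iff del: power_Suc fact_Suc of_nat_Suc)
    then have "Im (LINT r|lborel. f n r) = ((- x) ^ Suc n / fact (Suc n) * ?I n) * sin (pi * ?a)"
      by (simp del: power_Suc fact_Suc of_nat_Suc of_real_mult of_real_divide of_real_power)
    moreover have "(- (x * t powr (- \<beta>))) ^ Suc n = (- x) ^ Suc n * t powr (- ?a)"
    proof -
      have "t powr (- ?a) = (t powr (- \<beta>)) ^ Suc n"
        using t by (simp only: powr_powr [symmetric] minus_mult_left powr_realpow [symmetric] powr_gt_zero) 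
      then show ?thesis by (simp only: power_mult_distrib mult_minus_left [symmetric])
    qed
    ultimately show ?thesis
      using \<beta> by (subst rGamma_reflection_real) (auto simp del: power_Suc fact_Suc of_nat_Suc)
  qed
  have "(\<lambda>n. (- (x * t powr (- \<beta>))) ^ Suc n / fact (Suc n) * rGamma (1 - \<beta> * real (Suc n))) sums
     (Im (LINT r|lborel. exp (- of_real (t * exp r)) * (exp (- (of_real (x * exp (\<beta> * r)) * \<kappa>)) - 1)) / pi)"
    using sums_divide [OF S, of pi] unfolding im .
  from sums_Suc [OF this] show ?thesis
    unfolding wright_survival_def \<kappa>_def by (simp add: sums_iff)
qed

end

lemma continuous_on_Complex_line [continuous_intros]:
  "continuous_on A f \<Longrightarrow> continuous_on A (\<lambda>r. Complex (f r) y)"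
  unfolding Complex_eq by (intro continuous_intros)

text \<open>\<open>Ln\<close> inverts exp on this strip. It follows that ln s is the only zero of s
  - exp w there.\<close>

lemma exp_eq_of_real_imp:
  assumes "\<bar>Im w\<bar> < pi" "exp w = of_real s" "s > 0"
  shows "w = of_real (ln s)"
proof -
  have "Ln (exp w) = w" using assms by (intro Ln_exp) (auto simp: abs_less_iff)
  then show ?thesis using assms by (simp add: Ln_of_real)
qed

section \<open>The rotated line Im w = \<phi>: Cauchy's theorem, Fubini and the residue\<close>

context
  fixes \<beta> \<phi> :: real
  assumes \<beta>: "0 < \<beta>" "\<beta> < 1"
    and \<phi>: "pi / 2 < \<phi>" "\<phi> < pi" "\<beta> * \<phi> < pi / 2"
begin

lemma cos_angle_neg: "cos \<phi> < 0"
proof -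
  have "cos (pi - \<phi>) > 0" by (rule cos_gt_zero) (use \<phi> in auto)
  then show ?thesis by simp
qed

text \<open>The integrand is entire, and for fixed t it decays uniformly on the strip from \<phi> to
  pi: cos decreases there, so exp (t e^w) is at most exp (-t \<delta> e^r) in norm with \<delta> =
  -cos \<phi>. This beats even a growth of exp (x e^(\<beta> r)) in the other factor.\<close>

lemma wright_survival_rotated_integral:
  fixes x t :: real
  assumes x: "x \<ge> 0" and t: "t > 0"
  shows "wright_survival \<beta> (x * t powr (- \<beta>))
     = 1 + Im (LINT r|lborel. exp (of_real t * exp (Complex r \<phi>)) * (exp (- (of_real x * exp (of_real \<beta> * Complex r \<phi>))) - 1)) / pi"
proof -
  define G where "G w = exp (of_real t * exp w) * (exp (- (of_real x * exp (of_real \<beta> * w))) - 1)" for w :: complex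
  define \<delta> where "\<delta> = - cos \<phi>"
  have \<delta>: "\<delta> > 0" using cos_angle_neg by (simp add: \<delta>_def)
  have "t * \<delta> > 0" using t \<delta> by simp
  then obtain C where C: "C \<ge> 0"
    "\<And>r. x * exp (\<beta> * r) * exp (x * exp (\<beta> * r)) * exp (- (t * \<delta> * exp r)) \<le> C * (exp (\<beta> * r) * exp (- (t * \<delta> / 2 * exp r)))"
    using exp_exp_dominated [OF \<beta> x, of "t * \<delta>"] by blast
  let ?D = "\<lambda>r. C * (exp (\<beta> * r) * exp (- (t * \<delta> / 2 * exp r)))"
  have intD: "integrable lborel ?D"
    using has_bochner_integral_Gamma_log [of \<beta> "t * \<delta> / 2"] \<beta> t \<delta>
    by (intro integrable_mult_right) (auto simp: has_bochner_integral_iff)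
  have bound: "norm (G (Complex r y)) \<le> ?D r" if y: "y \<in> {\<phi>..pi}" for r y
  proof -
    have "cos y \<le> cos \<phi>"
      using y \<phi> by (intro cos_monotone_0_pi_le) auto
    then have "exp (t * (exp r * cos y)) \<le> exp (t * (exp r * cos \<phi>))"
      using t by (simp add: mult_left_mono)
    also have "\<dots> = exp (- (t * \<delta> * exp r))" by (simp add: \<delta>_def mult_ac)
    finally have 1: "norm (exp (of_real t * exp (Complex r y))) \<le> exp (- (t * \<delta> * exp r))"
      by (simp add: norm_exp_eq_Re Re_exp)
    have "norm (of_real x * exp (of_real \<beta> * Complex r y)) = x * exp (\<beta> * r)"
      using x by (simp add: norm_mult norm_exp_eq_Re)
    then have 2: "norm (exp (- (of_real x * exp (of_real \<beta> * Complex r y))) - 1) \<le> x * exp (\<beta> * r) * exp (x * exp (\<beta> * r))"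
      using norm_exp_minus_1_le_exp [of "of_real x * exp (of_real \<beta> * Complex r y)"] by simp
    have "norm (G (Complex r y)) \<le> exp (- (t * \<delta> * exp r)) * (x * exp (\<beta> * r) * exp (x * exp (\<beta> * r)))"
      unfolding G_def norm_mult by (intro mult_mono 1 2) auto
    also have "\<dots> \<le> ?D r"
      using C(2) [of r] by (simp only: mult_ac)
    finally show ?thesis .
  qed
  have holo: "G holomorphic_on UNIV"
    unfolding G_def [abs_def] by (intro holomorphic_intros)
  have int: "integrable lborel (\<lambda>r. G (Complex r y))" if y: "y \<in> {\<phi>..pi}" for y
  proof (rule Bochner_Integration.integrable_bound [OF intD])
    have "continuous_on UNIV (\<lambda>r. G (Complex r y))"
      unfolding G_def by (intro continuous_intros)
    then show "(\<lambda>r. G (Complex r y)) \<in> borel_measurable lborel"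
      by (auto intro: borel_measurable_continuous_onI)
    show "AE r in lborel. norm (G (Complex r y)) \<le> norm (?D r)"
      using bound [OF y] C(1) by (intro always_eventually allI) (auto simp: abs_mult)
  qed
  have "(LINT r|lborel. G (Complex r \<phi>)) - (LINT r|lborel. G (Complex r pi)) = 0"
  proof (rule horizontal_line_integrals_diff [where B="?D" and \<rho>=0])
    show "contour_integral (rectpath (Complex (- R) \<phi>) (Complex R pi)) G = 0" for R
      by (intro contour_integral_unique Cauchy_theorem_convex_simple [OF holo]) auto
    show "continuous_on (path_image (rectpath (Complex (- R) \<phi>) (Complex R pi))) G" for R
      by (rule continuous_on_subset [OF holomorphic_on_imp_continuous_on [OF holo]]) auto
    define d where "d = t * \<delta> / 2"
    have d: "d > 0" using t \<delta> by (simp add: d_def)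
    show "(?D \<longlongrightarrow> 0) at_top" "(?D \<longlongrightarrow> 0) at_bot"
      unfolding d_def [symmetric] using \<beta> d by real_asymp+
  qed (use \<phi> int bound in auto)
  moreover have "G (Complex r pi) = exp (- of_real (t * exp r)) * (exp (- (of_real (x * exp (\<beta> * r)) * exp (\<i> * of_real (pi * \<beta>)))) - 1)" for r
  proof -
    have "exp (Complex r pi) = - of_real (exp r)"
      by (simp add: Complex_eq exp_add exp_of_real mult.commute [of \<i>])
    moreover have "exp (of_real \<beta> * Complex r pi) = of_real (exp (\<beta> * r)) * exp (\<i> * of_real (pi * \<beta>))"
      by (simp add: Complex_eq distrib_left exp_add exp_of_real mult_ac flip: of_real_mult)
    ultimately show ?thesis by (simp add: G_def mult.assoc)
  qed
  ultimately show ?thesis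
    using wright_survival_log_integral [OF \<beta> x t] by (simp add: G_def)
qed

lemma norm_exp_stretched_minus_1_le:
  assumes x: "x \<ge> 0" and y: "\<bar>y\<bar> \<le> \<phi>"
  shows "norm (exp (- (of_real x * exp (of_real \<beta> * Complex r y))) - 1) \<le> x * exp (\<beta> * r)"
proof -
  have "\<bar>\<beta> * y\<bar> \<le> \<beta> * \<phi>" using \<beta> y by (simp add: abs_mult mult_left_mono)
  then have "cos (\<beta> * y) \<ge> 0" using \<phi> by (intro cos_ge_zero) auto
  then have "norm (exp (- (of_real x * exp (of_real \<beta> * Complex r y))) - 1) \<le> norm (of_real x * exp (of_real \<beta> * Complex r y))"
    using x by (intro norm_exp_minus_1_le) (simp add: Re_exp)
  then show ?thesis using x by (simp add: norm_mult norm_exp_eq_Re)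
qed

text \<open>With \<delta> = -cos \<phi>, the integrand is at most x e^(-s t) e^(\<beta> r) exp
  (-\<delta> t e^r) in norm. Its r-integral is x Gamma \<beta> (\<delta> t)^(-\<beta>) e^(-s t),
  integrable at t = 0 because \<beta> < 1. In the other order, exp (-(s - e^w) t) integrates to 1 /
  (s - e^w).\<close>

lemma stretched_kernel_Fubini:
  fixes x s :: real
  assumes x: "x > 0" and s: "s > 0"
  defines "A \<equiv> \<lambda>r. exp (- (of_real x * exp (of_real \<beta> * Complex r \<phi>))) - 1"
  shows "integrable lborel (\<lambda>t. indicator {0<..} t *\<^sub>R (exp (- of_real (s * t)) * (LINT r|lborel. exp (of_real t * exp (Complex r \<phi>)) * A r)))"
    and "(LINT t|lborel. indicator {0<..} t *\<^sub>R (exp (- of_real (s * t)) * (LINT r|lborel. exp (of_real t * exp (Complex r \<phi>)) * A r)))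
      = (LINT r|lborel. A r / (of_real s - exp (Complex r \<phi>)))"
    and "integrable lborel (\<lambda>r. A r / (of_real s - exp (Complex r \<phi>)))"
proof -
  define \<delta> where "\<delta> = - cos \<phi>"
  have \<delta>: "\<delta> > 0" using cos_angle_neg by (simp add: \<delta>_def)
  define F where "F t r = indicator {0<..} t *\<^sub>R (exp (- (of_real s - exp (Complex r \<phi>)) * of_real t) * A r)" for t r :: real
  have nF: "norm (F t r) \<le> (indicator {0<..} t * (x * exp (- (s * t)))) * (exp (\<beta> * r) * exp (- (\<delta> * t * exp r)))" for t r
  proof (cases "t > 0")
    case True
    have "norm (exp (- (of_real s - exp (Complex r \<phi>)) * of_real t)) = exp (- (s * t)) * exp (- (\<delta> * t * exp r))"
      by (simp add: norm_exp_eq_Re Re_exp \<delta>_def algebra_simps flip: exp_add)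
    moreover have "norm (A r) \<le> x * exp (\<beta> * r)"
      unfolding A_def using x \<phi> by (intro norm_exp_stretched_minus_1_le) auto
    ultimately have "norm (exp (- (of_real s - exp (Complex r \<phi>)) * of_real t) * A r)
      \<le> exp (- (s * t)) * exp (- (\<delta> * t * exp r)) * (x * exp (\<beta> * r))"
      unfolding norm_mult by (simp add: mult_left_mono)
    then show ?thesis using True by (simp add: F_def mult_ac)
  qed (simp add: F_def)
  have contA: "continuous_on UNIV (\<lambda>p. A (snd p))"
    unfolding A_def by (intro continuous_intros)
  have "(\<lambda>p. indicator {0<..} (fst p) *\<^sub>R (exp (- (of_real s - exp (Complex (snd p) \<phi>)) * of_real (fst p)) * A (snd p)))
       \<in> borel_measurable (borel :: (real \<times> real) measure)"
  proof (rule borel_measurable_scaleR)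
    show "(\<lambda>p. indicator {0<..} (fst p)) \<in> borel_measurable (borel :: (real \<times> real) measure)"
      by (simp add: borel_prod [symmetric])
  qed (intro borel_measurable_continuous_onI continuous_intros contA)
  then have meas: "(\<lambda>p. F (fst p) (snd p)) \<in> borel_measurable (lborel \<Otimes>\<^sub>M lborel)"
    by (simp add: F_def lborel_prod)
  then have meas' [measurable]: "case_prod F \<in> borel_measurable (lborel \<Otimes>\<^sub>M lborel)"
    by (simp add: case_prod_unfold)
  have gi: "has_bochner_integral lborel (\<lambda>r. exp (\<beta> * r) * exp (- (\<delta> * t * exp r))) (Gamma \<beta> * (\<delta> * t) powr (- \<beta>))"
    if "t > 0" for t
    using \<beta> \<delta> that by (intro has_bochner_integral_Gamma_log) auto
  have int2: "integrable lborel (F t)" for t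
  proof (cases "t > 0")
    case True
    show ?thesis
    proof (rule Bochner_Integration.integrable_bound)
      show "integrable lborel (\<lambda>r. (indicator {0<..} t * (x * exp (- (s * t)))) * (exp (\<beta> * r) * exp (- (\<delta> * t * exp r))))"
        using gi [OF True] by (intro integrable_mult_right) (simp add: has_bochner_integral_iff)
      show "AE r in lborel. norm (F t r) \<le> norm ((indicator {0<..} t * (x * exp (- (s * t)))) * (exp (\<beta> * r) * exp (- (\<delta> * t * exp r))))"
        using nF [of t] by (intro always_eventually allI) (rule order_trans, assumption, simp)
    qed measurable
  qed (simp add: F_def [abs_def])
  have int: "integrable (lborel \<Otimes>\<^sub>M lborel) (case_prod F)"
  proof (rule lborel_pair.Fubini_integrable)
    \<comment> \<open>The exponent (1 - \<beta>) - 1 displays t^(-\<beta>) as the Gamma integrand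
      with positive parameter 1 - \<beta>.\<close>
    have "integrable lborel (\<lambda>t. indicator {0<..} t * (t powr ((1 - \<beta>) - 1) * exp (- (s * t))))"
      using has_bochner_integral_powr_exp [of "1 - \<beta>" s] \<beta> s by (simp add: has_bochner_integral_iff)
    then have H: "integrable lborel (\<lambda>t. (x * Gamma \<beta> * \<delta> powr (- \<beta>)) * (indicator {0<..} t * (t powr ((1 - \<beta>) - 1) * exp (- (s * t)))))"
      by (rule integrable_mult_right)
    show "integrable lborel (\<lambda>t. LINT r|lborel. norm (case_prod F (t, r)))"
    proof (rule Bochner_Integration.integrable_bound [OF H])
      have "(\<lambda>t. LINT r|lborel. norm (F t r)) \<in> borel_measurable lborel"
        by measurable
      then show "(\<lambda>t. LINT r|lborel. norm (case_prod F (t, r))) \<in> borel_measurable lborel"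
        by simp
      have "norm (LINT r|lborel. norm (F t r)) \<le> norm ((x * Gamma \<beta> * \<delta> powr (- \<beta>)) * (indicator {0<..} t * (t powr ((1 - \<beta>) - 1) * exp (- (s * t)))))" for t
      proof (cases "t > 0")
        case True
        have "(LINT r|lborel. norm (F t r)) \<le> (LINT r|lborel. (indicator {0<..} t * (x * exp (- (s * t)))) * (exp (\<beta> * r) * exp (- (\<delta> * t * exp r))))"
          using gi [OF True] int2 nF
          by (intro integral_mono integrable_mult_right integrable_norm) (auto simp: has_bochner_integral_iff)
        also have "\<dots> = x * exp (- (s * t)) * (Gamma \<beta> * (\<delta> * t) powr (- \<beta>))"
          using gi [OF True] True by (simp add: has_bochner_integral_iff)
        also have "\<dots> = (x * Gamma \<beta> * \<delta> powr (- \<beta>)) * (t powr ((1 - \<beta>) - 1) * exp (- (s * t)))"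
          using True \<delta> by (simp add: powr_mult)
        finally show ?thesis using True by (simp add: integral_nonneg_AE)
      qed (simp add: F_def)
      then show "AE t in lborel. norm (LINT r|lborel. norm (case_prod F (t, r))) \<le> norm ((x * Gamma \<beta> * \<delta> powr (- \<beta>)) * (indicator {0<..} t * (t powr ((1 - \<beta>) - 1) * exp (- (s * t)))))"
        by simp
    qed
    show "AE t in lborel. integrable lborel (\<lambda>r. case_prod F (t, r))"
      using int2 by simp
  qed measurable
  have F1: "(LINT r|lborel. F t r) = indicator {0<..} t *\<^sub>R (exp (- of_real (s * t)) * (LINT r|lborel. exp (of_real t * exp (Complex r \<phi>)) * A r))" for t
  proof -
    have "F t r = (indicator {0<..} t *\<^sub>R exp (- of_real (s * t))) * (exp (of_real t * exp (Complex r \<phi>)) * A r)" for r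
      by (simp add: F_def algebra_simps flip: exp_add)
    then show ?thesis by simp
  qed
  have F2: "(LINT t|lborel. F t r) = A r / (of_real s - exp (Complex r \<phi>))" for r
  proof -
    let ?c = "of_real s - exp (Complex r \<phi>)"
    have "exp r * cos \<phi> < 0" using cos_angle_neg by (simp add: mult_pos_neg)
    then have "Re ?c > 0" using s by (simp add: Re_exp)
    from has_bochner_integral_mult_left [OF has_bochner_integral_exp_complex [OF this], of "A r"]
    show ?thesis by (simp add: F_def has_bochner_integral_iff)
  qed
  show "integrable lborel (\<lambda>t. indicator {0<..} t *\<^sub>R (exp (- of_real (s * t)) * (LINT r|lborel. exp (of_real t * exp (Complex r \<phi>)) * A r)))"
    using lborel_pair.integrable_fst [OF int] by (simp add: F1)
  show "(LINT t|lborel. indicator {0<..} t *\<^sub>R (exp (- of_real (s * t)) * (LINT r|lborel. exp (of_real t * exp (Complex r \<phi>)) * A r)))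
      = (LINT r|lborel. A r / (of_real s - exp (Complex r \<phi>)))"
    using lborel_pair.Fubini_integral [OF int] by (simp only: F1 F2)
  show "integrable lborel (\<lambda>r. A r / (of_real s - exp (Complex r \<phi>)))"
    using lborel_pair.integrable_snd [OF int] by (simp only: F2)
qed

text \<open>The contour lies between the line and its conjugate, where the integrand takes conjugate
  values. The difference of the two line integrals is therefore -2i times the wanted imaginary part,
  and the strip contains a single simple pole.\<close>

lemma stretched_kernel_residue:
  fixes x s :: real
  assumes x: "x > 0" and s: "s > 0"
  shows "Im (LINT r|lborel. (exp (- (of_real x * exp (of_real \<beta> * Complex r \<phi>))) - 1) / (of_real s - exp (Complex r \<phi>)))
     = pi * (exp (- x * s powr \<beta>) - 1) / s"
proof -
  define f where "f w = exp (- (of_real x * exp (of_real \<beta> * w))) - 1" for w :: complex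
  define g where "g w = f w / (of_real s - exp w)" for w :: complex
  define S where "S = {w. \<bar>Im w\<bar> < pi}"
  have S: "open S" "convex S"
  proof -
    have "S = {w. Im w < pi} \<inter> {w. Im w > - pi}" by (auto simp: S_def abs_less_iff)
    then show "open S" "convex S"
      by (auto intro!: open_Int convex_Int open_halfspace_Im_lt open_halfspace_Im_gt convex_halfspace_Im_lt convex_halfspace_Im_gt)
  qed
  let ?p = "of_real (ln s) :: complex"
  have nz: "of_real s - exp w \<noteq> 0" if "w \<in> S - {?p}" for w
    using exp_eq_of_real_imp [of w s] that s by (auto simp: S_def)
  have holo: "g holomorphic_on S - {?p}"
    unfolding g_def f_def by (intro holomorphic_intros nz)
  have pS: "?p \<in> S" by (simp add: S_def)
  have fp: "f ?p = of_real (exp (- x * s powr \<beta>) - 1)"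
  proof -
    have "exp (of_real \<beta> * ?p) = of_real (s powr \<beta>)"
      using s by (simp add: powr_def flip: of_real_mult exp_of_real)
    then show ?thesis unfolding f_def by (simp flip: exp_of_real)
  qed
  \<comment> \<open>The denominator has derivative -s at ln s, and the numerator takes its value
    from exp (\<beta> ln s) = s^\<beta>.\<close>
  have res: "residue g ?p = of_real (exp (- x * s powr \<beta>) - 1) / (- of_real s)"
    unfolding g_def fp [symmetric]
  proof (rule residue_simple_pole_deriv [OF _ _ S(1) convex_connected [OF S(2)] pS])
    show "f holomorphic_on S" unfolding f_def by (intro holomorphic_intros)
    show "f ?p \<noteq> 0" using x s unfolding fp by simp
    show "((\<lambda>w. of_real s - exp w) has_field_derivative - of_real s) (at ?p)"
      using s by (auto intro!: derivative_eq_intros simp: exp_of_real)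
  qed (use s in \<open>auto intro!: holomorphic_intros simp: exp_of_real\<close>)
  have int: "integrable lborel (\<lambda>r. g (Complex r \<phi>))"
    using stretched_kernel_Fubini(3) [OF x s] by (simp add: g_def f_def)
  have gc: "g (Complex r (- \<phi>)) = cnj (g (Complex r \<phi>))" for r
    by (simp add: g_def f_def exp_cnj Complex_eq)
  \<comment> \<open>For R \<ge> \<open>R0\<close> the pole is strictly inside the rectangle, and exp
    r differs from s on the vertical sides.\<close>
  define R0 where "R0 = \<bar>ln s\<bar> + 1"
  have ab: "- \<phi> < \<phi>" using \<phi> pi_gt_zero by linarith
  have sub: "path_image (rectpath (Complex (- R) (- \<phi>)) (Complex R \<phi>)) \<subseteq> S - {?p}" if "R \<ge> R0" for R
    using that ab \<phi> by (subst path_image_rectpath) (auto simp: S_def R0_def)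
  have "(LINT r|lborel. g (Complex r (- \<phi>))) - (LINT r|lborel. g (Complex r \<phi>)) = 2 * pi * \<i> * residue g ?p"
  proof (rule horizontal_line_integrals_diff [OF ab, where \<rho>=R0 and B="\<lambda>r. x * exp (\<beta> * r) / \<bar>s - exp r\<bar>"])
    fix R assume R: "R \<ge> R0"
    show "continuous_on (path_image (rectpath (Complex (- R) (- \<phi>)) (Complex R \<phi>))) g"
      by (rule continuous_on_subset [OF holomorphic_on_imp_continuous_on [OF holo] sub [OF R]])
    have "contour_integral (rectpath (Complex (- R) (- \<phi>)) (Complex R \<phi>)) g
       = 2 * pi * \<i> * (\<Sum>p\<in>{?p}. winding_number (rectpath (Complex (- R) (- \<phi>)) (Complex R \<phi>)) p * residue g p)"
    proof (rule Residue_theorem [OF S(1) convex_connected [OF S(2)] _ holo])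
      show "\<forall>z. z \<notin> S \<longrightarrow> winding_number (rectpath (Complex (- R) (- \<phi>)) (Complex R \<phi>)) z = 0"
        using sub [OF R] by (auto intro!: winding_number_zero_outside [OF _ S(2)])
    qed (use sub [OF R] in auto)
    moreover have "winding_number (rectpath (Complex (- R) (- \<phi>)) (Complex R \<phi>)) ?p = 1"
      using R ab by (intro winding_number_rectpath) (auto simp: in_box_complex_iff R0_def)
    ultimately show "contour_integral (rectpath (Complex (- R) (- \<phi>)) (Complex R \<phi>)) g = 2 * pi * \<i> * residue g ?p"
      by simp
  next
    show "integrable lborel (\<lambda>r. g (Complex r \<phi>))" by (rule int)
    show "integrable lborel (\<lambda>r. g (Complex r (- \<phi>)))" unfolding gc using int by simp
    fix r y assume r: "\<bar>r\<bar> \<ge> R0" and y: "y \<in> {- \<phi>..\<phi>}"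
    have "s \<noteq> exp r" using r s by (auto simp: R0_def)
    moreover have "\<bar>s - exp r\<bar> \<le> norm (of_real s - exp (Complex r y))"
      using norm_triangle_ineq3 [of "of_real s" "exp (Complex r y)"] s by (simp add: norm_exp_eq_Re)
    moreover have "norm (f (Complex r y)) \<le> x * exp (\<beta> * r)"
      unfolding f_def using x y by (intro norm_exp_stretched_minus_1_le) auto
    ultimately show "norm (g (Complex r y)) \<le> x * exp (\<beta> * r) / \<bar>s - exp r\<bar>"
      unfolding g_def norm_divide by (intro frac_le) (use x in auto)
  next
    \<comment> \<open>The bound behaves like x e^((\<beta> - 1) r) at infinity and like x e^(\<beta>
      r) / s at -infinity, so \<beta> < 1 acts at one end and \<beta> > 0 at the other.\<close>
    show "((\<lambda>r. x * exp (\<beta> * r) / \<bar>s - exp r\<bar>) \<longlongrightarrow> 0) at_top"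
      "((\<lambda>r. x * exp (\<beta> * r) / \<bar>s - exp r\<bar>) \<longlongrightarrow> 0) at_bot"
      using \<beta> x s by real_asymp+
  qed
  then have "cnj (LINT r|lborel. g (Complex r \<phi>)) - (LINT r|lborel. g (Complex r \<phi>)) = 2 * pi * \<i> * residue g ?p"
    unfolding gc by simp
  from arg_cong [OF this, of Im] show ?thesis
    using s unfolding res by (simp add: g_def f_def field_simps)
qed

end

text \<open>The constant 1 contributes 1/s, which cancels the -1 in the residue. A suitable angle
  exists because \<beta> < 1 makes pi / (2 \<beta>) larger than pi/2.\<close>

lemma wright_survival_laplace:
  fixes \<beta> x s :: real
  assumes \<beta>: "0 < \<beta>" "\<beta> < 1" and x: "x > 0" and s: "s > 0"
  shows "has_bochner_integral lborel (\<lambda>t. indicator {0<..} t * (exp (- (s * t)) * wright_survival \<beta> (x * t powr (- \<beta>)))) (exp (- x * s powr \<beta>) / s)"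
proof -
  have "pi / 2 < min pi (pi / (2 * \<beta>))" using \<beta> by (auto simp: field_simps)
  then obtain \<phi> where "pi / 2 < \<phi>" "\<phi> < min pi (pi / (2 * \<beta>))"
    using dense by blast
  then have \<phi>: "pi / 2 < \<phi>" "\<phi> < pi" "\<beta> * \<phi> < pi / 2"
    using \<beta> by (auto simp: field_simps)
  define K where "K t = (LINT r|lborel. exp (of_real t * exp (Complex r \<phi>)) * (exp (- (of_real x * exp (of_real \<beta> * Complex r \<phi>))) - 1))" for t :: real
  note Fub = stretched_kernel_Fubini [OF \<beta> \<phi> x s, folded K_def]
  have "has_bochner_integral lborel (\<lambda>t. Im (indicator {0<..} t *\<^sub>R (exp (- of_real (s * t)) * K t))) (pi * (exp (- x * s powr \<beta>) - 1) / s)"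
    using Fub stretched_kernel_residue [OF \<beta> \<phi> x s]
    by (simp only: has_bochner_integral_iff integrable_Im integral_Im) 
  from has_bochner_integral_add [OF has_bochner_integral_power_exp [OF s, of 0] has_bochner_integral_mult_left [OF this, of "1 / pi"]]
  have "has_bochner_integral lborel (\<lambda>t. indicator {0<..} t * (t ^ 0 * exp (- (s * t))) + Im (indicator {0<..} t *\<^sub>R (exp (- of_real (s * t)) * K t)) * (1 / pi))
     (fact 0 / s ^ Suc 0 + pi * (exp (- x * s powr \<beta>) - 1) / s * (1 / pi))"
    by simp
  also have "(\<lambda>t. indicator {0<..} t * (t ^ 0 * exp (- (s * t))) + Im (indicator {0<..} t *\<^sub>R (exp (- of_real (s * t)) * K t)) * (1 / pi))
    = (\<lambda>t. indicator {0<..} t * (exp (- (s * t)) * wright_survival \<beta> (x * t powr (- \<beta>))))"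
  proof
    fix t :: real
    have "Im (exp (- of_real (s * t)) * K t) = exp (- (s * t)) * Im (K t)"
      by (simp add: exp_of_real flip: of_real_mult of_real_minus)
    then show "indicator {0<..} t * (t ^ 0 * exp (- (s * t))) + Im (indicator {0<..} t *\<^sub>R (exp (- of_real (s * t)) * K t)) * (1 / pi)
      = indicator {0<..} t * (exp (- (s * t)) * wright_survival \<beta> (x * t powr (- \<beta>)))"
      using wright_survival_rotated_integral [OF \<beta> \<phi>, of x t] x
      by (cases "t > 0") (simp_all add: K_def algebra_simps)
  qed
  also have "fact 0 / s ^ Suc 0 + pi * (exp (- x * s powr \<beta>) - 1) / s * (1 / pi) = exp (- x * s powr \<beta>) / s"
    using s by (simp add: field_simps)
  finally show ?thesis .
qed

section \<open>The stable subordinator\<close>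

context prob_space
begin

lemma continuous_at_right_prob_le:
  fixes Z :: "'a \<Rightarrow> real"
  assumes [measurable]: "random_variable borel Z"
  shows "continuous (at_right t) (\<lambda>t. prob {\<omega> \<in> space M. Z \<omega> \<le> t})"
proof -
  interpret D: prob_space "distr M borel Z" by (rule prob_space_distr) simp
  interpret finite_borel_measure "distr M borel Z" by unfold_locales auto
  have "cdf (distr M borel Z) = (\<lambda>t. prob {\<omega> \<in> space M. Z \<omega> \<le> t})"
    by (auto simp: fun_eq_iff cdf_def measure_distr intro!: arg_cong [where f=prob])
  then show ?thesis using cdf_is_right_cont [of t] by simp
qed

text \<open>Tonelli: integrating exp (-s t) over t \<ge> Z gives exp (-s Z) / s. As Z is almost
  surely nonnegative, the restriction to t > 0 loses nothing.\<close>

lemma has_bochner_integral_laplace_prob_le: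
  fixes Z :: "'a \<Rightarrow> real"
  assumes Z [measurable]: "random_variable borel Z" and pos: "AE \<omega> in M. 0 \<le> Z \<omega>" and s: "s > 0"
  shows "has_bochner_integral lborel (\<lambda>t. indicator {0<..} t * (exp (- (s * t)) * prob {\<omega> \<in> space M. Z \<omega> \<le> t})) (expectation (\<lambda>\<omega>. exp (- s * Z \<omega>)) / s)"
proof -
  interpret P: pair_sigma_finite lborel M
    by unfold_locales
  let ?g = "\<lambda>t \<omega>. ennreal (indicator {0<..} t * exp (- (s * t))) * indicator {\<omega> \<in> space M. Z \<omega> \<le> t} \<omega>"
  have "(\<integral>\<^sup>+t. ennreal (indicator {0<..} t * (exp (- (s * t)) * prob {\<omega> \<in> space M. Z \<omega> \<le> t})) \<partial>lborel)
      = (\<integral>\<^sup>+t. (\<integral>\<^sup>+\<omega>. ?g t \<omega> \<partial>M) \<partial>lborel)"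
  proof (rule nn_integral_cong)
    fix t :: real
    have "(\<integral>\<^sup>+\<omega>. ?g t \<omega> \<partial>M) = ennreal (indicator {0<..} t * exp (- (s * t))) * emeasure M {\<omega> \<in> space M. Z \<omega> \<le> t}"
      by (rule nn_integral_cmult_indicator) measurable
    also have "\<dots> = ennreal (indicator {0<..} t * exp (- (s * t)) * prob {\<omega> \<in> space M. Z \<omega> \<le> t})"
      unfolding emeasure_eq_measure by (rule ennreal_mult [symmetric]) auto
    finally show "ennreal (indicator {0<..} t * (exp (- (s * t)) * prob {\<omega> \<in> space M. Z \<omega> \<le> t})) = (\<integral>\<^sup>+\<omega>. ?g t \<omega> \<partial>M)"
      by (simp only: mult.assoc)
  qed
  also have "\<dots> = (\<integral>\<^sup>+\<omega>. (\<integral>\<^sup>+t. ?g t \<omega> \<partial>lborel) \<partial>M)"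
    by (rule P.Fubini' [symmetric]) measurable
  also have "\<dots> = (\<integral>\<^sup>+\<omega>. ennreal (exp (- s * Z \<omega>) / s) \<partial>M)"
  proof (rule nn_integral_cong_AE)
    show "AE \<omega> in M. (\<integral>\<^sup>+t. ?g t \<omega> \<partial>lborel) = ennreal (exp (- s * Z \<omega>) / s)"
      using pos AE_space
    proof eventually_elim
      case (elim \<omega>)
      have "(\<integral>\<^sup>+t. ?g t \<omega> \<partial>lborel) = (\<integral>\<^sup>+t. ennreal (exp (- (s * t))) * indicator {Z \<omega>..} t \<partial>lborel)"
      proof (rule nn_integral_cong_AE)
        show "AE t in lborel. ?g t \<omega> = ennreal (exp (- (s * t))) * indicator {Z \<omega>..} t"
          using AE_lborel_singleton [of 0] by eventually_elim (use elim in \<open>auto simp: indicator_def\<close>)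
      qed
      also have "\<dots> = ennreal (0 - (- exp (- (s * Z \<omega>)) / s))"
      proof (rule nn_integral_FTC_atLeast)
        show "((\<lambda>t. - exp (- (s * t)) / s) has_real_derivative exp (- (s * x))) (at x)" for x
          using s by (auto intro!: derivative_eq_intros)
        show "((\<lambda>t. - exp (- (s * t)) / s) \<longlongrightarrow> 0) at_top"
          using s by real_asymp
      qed auto
      finally show ?case by simp
    qed
  qed
  also have "\<dots> = ennreal (expectation (\<lambda>\<omega>. exp (- s * Z \<omega>) / s))"
  proof (rule nn_integral_eq_integral)
    have "integrable M (\<lambda>\<omega>. exp (- s * Z \<omega>))"
      using pos s by (intro integrable_const_bound [where B=1]) auto
    then show "integrable M (\<lambda>\<omega>. exp (- s * Z \<omega>) / s)" by simp
  qed (use s in auto)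
  finally show ?thesis
    using s by (intro has_bochner_integral_nn_integral) (auto intro!: integral_nonneg_AE divide_nonneg_nonneg)
qed

end

lemma wright_survival_0 [simp]: "wright_survival \<beta> 0 = 1"
  unfolding wright_survival_def by (subst suminf_finite [of "{0}"]) auto

lemma isCont_wright_survival:
  assumes "0 < \<beta>" "\<beta> < 1"
  shows "isCont (wright_survival \<beta>) z"
  using wright_survival_has_derivative [OF assms] by (rule DERIV_isCont)

lemma stable_subordinatorD:
  assumes "stable_subordinator \<beta> M S"
  shows "prob_space M" "\<And>x. x \<ge> 0 \<Longrightarrow> S x \<in> borel_measurable M"
    "AE \<omega> in M. S 0 \<omega> = 0" "AE \<omega> in M. mono_on {0..} (\<lambda>x. S x \<omega>)"
    "\<And>x s. x \<ge> 0 \<Longrightarrow> s \<ge> 0 \<Longrightarrow> prob_space.expectation M (\<lambda>\<omega>. exp (- s * S x \<omega>)) = exp (- x * s powr \<beta>)"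
  using assms by (auto simp: stable_subordinator_def levy_process_def)

lemma stable_subordinator_nonneg:
  assumes "stable_subordinator \<beta> M S" "x \<ge> 0"
  shows "AE \<omega> in M. 0 \<le> S x \<omega>"
  using stable_subordinatorD(3,4) [OF assms(1)]
  by eventually_elim (use assms(2) in \<open>auto dest: mono_onD [where r=0 and s=x]\<close>)

text \<open>As functions of t, both sides have the transform exp (-x s^\<beta>) / s. The comparison
  starts at k = 1 because both transforms are available for s > 0.\<close>

lemma prob_stable_subordinator_le:
  assumes \<beta>: "0 < \<beta>" "\<beta> < 1" and S: "stable_subordinator \<beta> M S" and x: "x > 0" and t: "t > 0"
  shows "measure M {\<omega> \<in> space M. S x \<omega> \<le> t} = wright_survival \<beta> (x * t powr (- \<beta>))"
proof -
  interpret prob_space M by (rule stable_subordinatorD [OF S])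
  have [measurable]: "S x \<in> borel_measurable M" using stable_subordinatorD(2) [OF S] x by simp
  let ?g = "\<lambda>t. prob {\<omega> \<in> space M. S x \<omega> \<le> t} - wright_survival \<beta> (x * t powr (- \<beta>))"
  have "has_bochner_integral lborel (\<lambda>t. indicator {0<..} t * (exp (- (real k * t)) * ?g t)) 0" if "k \<ge> 1" for k :: nat
  proof -
    have k: "real k > 0" using that by simp
    have "has_bochner_integral lborel (\<lambda>t. indicator {0<..} t * (exp (- (real k * t)) * prob {\<omega> \<in> space M. S x \<omega> \<le> t})) (exp (- x * real k powr \<beta>) / real k)"
      using has_bochner_integral_laplace_prob_le [OF _ stable_subordinator_nonneg [OF S] k, of x]
        stable_subordinatorD(5) [OF S, of x "real k"] x by simp
    from has_bochner_integral_diff [OF this wright_survival_laplace [OF \<beta> x k]]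
    show ?thesis by (simp add: right_diff_distrib)
  qed
  then have "?g t = 0"
  proof (intro laplace_transform_unique_right_continuous [where g="?g" and ?k0.0=1])
    have "isCont (\<lambda>t. wright_survival \<beta> (x * t powr (- \<beta>))) t"
      using t by (intro isCont_o2 [OF _ isCont_wright_survival [OF \<beta>]] continuous_intros) auto
    then show "continuous (at_right t) ?g"
      by (intro continuous_diff continuous_at_right_prob_le) (measurable, rule continuous_at_imp_continuous_at_within)
  qed (use t in \<open>auto simp: has_bochner_integral_iff\<close>)
  then show ?thesis by simp
qed

text \<open>All three are read off from W z = P (S z \<le> 1) for z > 0, the case t = 1 of
  \<open>prob_stable_subordinator_le\<close>; monotone paths make W antitone.\<close>

lemma
  assumes \<beta>: "0 < \<beta>" "\<beta> < 1" and S: "stable_subordinator \<beta> M S"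
  shows wright_survival_bounds: "z \<ge> 0 \<Longrightarrow> wright_survival \<beta> z \<in> {0..1}"
    and wright_survival_antimono: "0 \<le> y \<Longrightarrow> y \<le> z \<Longrightarrow> wright_survival \<beta> z \<le> wright_survival \<beta> y"
    and wright_survival_tendsto: "(wright_survival \<beta> \<longlongrightarrow> 0) at_top"
proof -
  interpret prob_space M by (rule stable_subordinatorD [OF S])
  have meas [measurable]: "S x \<in> borel_measurable M" if "x > 0" for x
    using stable_subordinatorD(2) [OF S] that by simp
  have W: "wright_survival \<beta> z = prob {\<omega> \<in> space M. S z \<omega> \<le> 1}" if "z > 0" for z
    using prob_stable_subordinator_le [OF \<beta> S that, of 1] by simp
  show bd: "wright_survival \<beta> z \<in> {0..1}" if "z \<ge> 0" for z
    using W [of z] that by (cases "z = 0") auto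
  show "wright_survival \<beta> z \<le> wright_survival \<beta> y" if "0 \<le> y" "y \<le> z" for y z
  proof (cases "y = 0")
    case True
    then show ?thesis using bd [of z] that by simp
  next
    case False
    then have "y > 0" "z > 0" using that by auto
    moreover have "AE \<omega> in M. \<omega> \<in> {\<omega> \<in> space M. S z \<omega> \<le> 1} \<longrightarrow> \<omega> \<in> {\<omega> \<in> space M. S y \<omega> \<le> 1}"
      using stable_subordinatorD(4) [OF S]
      by eventually_elim (use that in \<open>auto dest!: mono_onD [where r=y and s=z]\<close>)
    ultimately show ?thesis
      by (auto simp: W intro!: finite_measure_mono_AE)
  qed
  \<comment> \<open>A Chernoff bound: the indicator of S z \<le> 1 is at most exp (1 - S z), whose
    expectation is exp (1 - z).\<close>
  have "wright_survival \<beta> z \<le> exp (1 - z)" if "z > 0" for z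
  proof -
    have int: "integrable M (\<lambda>\<omega>. exp (1 - S z \<omega>))"
      using stable_subordinator_nonneg [OF S, of z] that
      by (intro integrable_const_bound [where B="exp 1"]) auto
    have "prob {\<omega> \<in> space M. S z \<omega> \<le> 1} = expectation (indicator {\<omega> \<in> space M. S z \<omega> \<le> 1})"
      using that by simp
    also have "\<dots> \<le> expectation (\<lambda>\<omega>. exp (1 - S z \<omega>))"
      using that int by (intro integral_mono) (auto simp: indicator_def less_top[symmetric])
    also have "\<dots> = exp 1 * expectation (\<lambda>\<omega>. exp (- 1 * S z \<omega>))"
      by (simp add: exp_diff exp_minus divide_inverse)
    also have "\<dots> = exp (1 - z)"
      using stable_subordinatorD(5) [OF S, of z 1] that by (simp add: exp_diff exp_minus divide_inverse)
    finally show ?thesis using W [OF that] by simp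
  qed
  then have "eventually (\<lambda>z. norm (wright_survival \<beta> z) \<le> exp (1 - z)) at_top"
    using bd by (intro eventually_mono [OF eventually_gt_at_top [of 0]]) (auto simp: less_imp_le)
  moreover have "((\<lambda>z::real. exp (1 - z)) \<longlongrightarrow> 0) at_top" by real_asymp
  ultimately show "(wright_survival \<beta> \<longlongrightarrow> 0) at_top"
    by (rule Lim_null_comparison)
qed

text \<open>At interior points it is minus the derivative of an antitone function; the value at 0
  follows by continuity.\<close>

lemma M_Wright_nonneg:
  assumes \<beta>: "0 < \<beta>" "\<beta> < 1" and S: "stable_subordinator \<beta> M S" and z: "z \<ge> 0"
  shows "M_Wright \<beta> z \<ge> 0"
proof -
  have pos: "M_Wright \<beta> z \<ge> 0" if "z > 0" for z
  proof -
    have "mono_on {0..} (\<lambda>z. - wright_survival \<beta> z)"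
      using wright_survival_antimono [OF \<beta> S] by (auto intro!: mono_onI)
    moreover have "((\<lambda>z. - wright_survival \<beta> z) has_real_derivative M_Wright \<beta> z) (at z)"
      using DERIV_minus [OF wright_survival_has_derivative [OF \<beta>, of z]] by simp
    ultimately show ?thesis
      using that by (intro mono_on_imp_deriv_nonneg [where A="{0..}" and x=z]) (auto simp: interior_Ici [of "-1"])
  qed
  moreover have "M_Wright \<beta> 0 \<ge> 0"
  proof (rule tendsto_lowerbound)
    show "(M_Wright \<beta> \<longlongrightarrow> M_Wright \<beta> 0) (at_right 0)"
      using isCont_M_Wright [OF \<beta>, of 0] by (auto simp: isCont_def intro: filterlim_at_split [THEN iffD1, THEN conjunct2])
    show "eventually (\<lambda>z. M_Wright \<beta> z \<ge> 0) (at_right 0)"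
      using pos by (auto simp: eventually_at_right_field intro: exI [of _ 1])
  qed simp
  ultimately show ?thesis using z by (cases "z = 0") auto
qed

section \<open>The M-Wright density and the law of the inverse subordinator\<close>

lemma wright_survival_scaled_has_derivative:
  assumes \<beta>: "0 < \<beta>" "\<beta> < 1"
  shows "((\<lambda>x. wright_survival \<beta> (x * c)) has_real_derivative - (c * M_Wright \<beta> (x * c))) (at x)"
proof -
  have "((\<lambda>x. wright_survival \<beta> (x * c)) has_real_derivative - M_Wright \<beta> (x * c) * c) (at x)"
    by (rule DERIV_chain' [OF _ wright_survival_has_derivative [OF \<beta>]]) (auto intro!: derivative_eq_intros)
  then show ?thesis by (simp add: mult.commute)
qed

lemma borel_measurable_M_Wright [measurable]:
  assumes "0 < \<beta>" "\<beta> < 1"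
  shows "M_Wright \<beta> \<in> borel_measurable borel"
  using isCont_M_Wright [OF assms] by (intro borel_measurable_continuous_onI continuous_at_imp_continuous_on) auto

lemma borel_measurable_wright_survival [measurable]:
  assumes "0 < \<beta>" "\<beta> < 1"
  shows "wright_survival \<beta> \<in> borel_measurable borel"
  using isCont_wright_survival [OF assms] by (intro borel_measurable_continuous_onI continuous_at_imp_continuous_on) auto

text \<open>An antiderivative is -W (y c), which rises from -1 at 0 to 0 at infinity. The sign from
  \<open>M_Wright_nonneg\<close> turns this into integrability on the half-line.\<close>

lemma
  assumes \<beta>: "0 < \<beta>" "\<beta> < 1" and S: "stable_subordinator \<beta> M S" and c: "c > 0"
  shows nn_integral_M_Wright_atLeastAtMost:
      "x \<ge> 0 \<Longrightarrow> (\<integral>\<^sup>+y. ennreal (c * M_Wright \<beta> (y * c)) * indicator {0..x} y \<partial>lborel) = ennreal (1 - wright_survival \<beta> (x * c))"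
    and has_bochner_integral_M_Wright:
      "has_bochner_integral lborel (\<lambda>y. indicator {0<..} y * (c * M_Wright \<beta> (y * c))) 1"
proof -
  note [measurable] = borel_measurable_M_Wright [OF \<beta>]
  have nn: "c * M_Wright \<beta> (y * c) \<ge> 0" if "y \<ge> 0" for y
    using M_Wright_nonneg [OF \<beta> S] that c by auto
  have D: "((\<lambda>x. - wright_survival \<beta> (x * c)) has_real_derivative c * M_Wright \<beta> (x * c)) (at x)" for x
    using DERIV_minus [OF wright_survival_scaled_has_derivative [OF \<beta>]] by simp
  show "(\<integral>\<^sup>+y. ennreal (c * M_Wright \<beta> (y * c)) * indicator {0..x} y \<partial>lborel) = ennreal (1 - wright_survival \<beta> (x * c))"
    if "x \<ge> 0" for x
    using nn_integral_FTC_Icc [of "\<lambda>y. c * M_Wright \<beta> (y * c)" 0 x "\<lambda>x. - wright_survival \<beta> (x * c)"] nn D that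
    by (simp add: has_field_derivative_at_within)
  have "filterlim (\<lambda>x. x * c) at_top at_top" using c by real_asymp
  from filterlim_compose [OF wright_survival_tendsto [OF \<beta> S] this]
  have lim: "((\<lambda>x. - wright_survival \<beta> (x * c)) \<longlongrightarrow> 0) at_top"
    using tendsto_minus by fastforce
  have "(\<integral>\<^sup>+y. ennreal (indicator {0<..} y * (c * M_Wright \<beta> (y * c))) \<partial>lborel)
      = (\<integral>\<^sup>+y. ennreal (c * M_Wright \<beta> (y * c)) * indicator {0..} y \<partial>lborel)"
    by (rule nn_integral_cong_AE) (use AE_lborel_singleton [of 0] in eventually_elim, auto simp: indicator_def)
  also have "\<dots> = ennreal (0 - (- wright_survival \<beta> (0 * c)))"
    by (rule nn_integral_FTC_atLeast [OF _ D nn lim]) auto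
  finally show "has_bochner_integral lborel (\<lambda>y. indicator {0<..} y * (c * M_Wright \<beta> (y * c))) 1"
    using nn by (intro has_bochner_integral_nn_integral) (auto simp: indicator_def)
qed

text \<open>Writing E for the inverse subordinator at t, monotone paths give the inclusions of E < x
  in t < S x and of t < S x in E \<le> x, up to null sets. Only the event E = x could separate the
  probabilities, and \<open>atom\<close> removes it.\<close>

lemma prob_inverse_subordinator_le:
  assumes \<beta>: "0 < \<beta>" "\<beta> < 1" and S: "stable_subordinator \<beta> M S"
    and t: "t > 0" and x: "x > 0"
    and meas: "inverse_subordinator S t \<in> borel_measurable M"
    and atom: "measure M {\<omega> \<in> space M. inverse_subordinator S t \<omega> = x} = 0"
  shows "measure M {\<omega> \<in> space M. inverse_subordinator S t \<omega> \<le> x} = 1 - wright_survival \<beta> (x * t powr (- \<beta>))"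
proof -
  interpret prob_space M by (rule stable_subordinatorD [OF S])
  note [measurable] = meas
  have Sm: "S y \<in> borel_measurable M" if "y \<ge> 0" for y
    using stable_subordinatorD(2) [OF S] that by simp
  have [measurable]: "S x \<in> borel_measurable M" using Sm x by simp
  have [measurable]: "S (real n) \<in> borel_measurable M" for n by (rule Sm) simp
  let ?E = "inverse_subordinator S t"
  \<comment> \<open>By monotonicity, on B almost surely no x has S x > t, and the infimum of the
    empty set is unspecified. B is null because W tends to 0.\<close>
  define B where "B = {\<omega> \<in> space M. \<forall>n. S (real n) \<omega> \<le> t}"
  have B [measurable]: "B \<in> events" unfolding B_def by measurable
  have "prob B \<le> 0"
  proof (rule LIMSEQ_le_const)
    have "filterlim (\<lambda>n. real n * t powr (- \<beta>)) at_top sequentially" using t by real_asymp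
    from filterlim_compose [OF wright_survival_tendsto [OF \<beta> S] this]
    show "(\<lambda>n. wright_survival \<beta> (real n * t powr (- \<beta>))) \<longlonglongrightarrow> 0" .
    have "prob B \<le> wright_survival \<beta> (real n * t powr (- \<beta>))" if "n \<ge> 1" for n
    proof -
      have "prob B \<le> prob {\<omega> \<in> space M. S (real n) \<omega> \<le> t}"
        by (intro finite_measure_mono) (auto simp: B_def)
      then show ?thesis using prob_stable_subordinator_le [OF \<beta> S _ t, of "real n"] that by simp
    qed
    then show "\<exists>N. \<forall>n\<ge>N. prob B \<le> wright_survival \<beta> (real n * t powr (- \<beta>))" by blast
  qed
  then have "prob B = 0" by (simp add: measure_le_0_iff)
  then have AEB: "AE \<omega> in M. \<omega> \<notin> B" using prob_eq_0 [OF B] by simp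
  have 1: "t < S x \<omega> \<Longrightarrow> ?E \<omega> \<le> x" for \<omega>
    unfolding inverse_subordinator_def using x by (intro cInf_lower bdd_belowI [of _ 0]) auto
  have 2: "AE \<omega> in M. ?E \<omega> < x \<longrightarrow> t < S x \<omega>"
    using stable_subordinatorD(4) [OF S] AEB AE_space
  proof eventually_elim
    case (elim \<omega>)
    then obtain n where n: "t < S (real n) \<omega>" by (auto simp: B_def not_le)
    show ?case
    proof (rule impI, rule ccontr)
      assume lt: "?E \<omega> < x" and "\<not> t < S x \<omega>"
      have "x \<le> ?E \<omega>"
        unfolding inverse_subordinator_def
      proof (rule cInf_greatest)
        show "{x. 0 \<le> x \<and> t < S x \<omega>} \<noteq> {}" using n by (auto intro: exI [of _ "real n"])
        fix y assume y: "y \<in> {x. 0 \<le> x \<and> t < S x \<omega>}"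
        show "x \<le> y"
        proof (rule ccontr)
          assume "\<not> x \<le> y"
          then have "S y \<omega> \<le> S x \<omega>" using elim y x by (intro mono_onD [of "{0..}" "\<lambda>x. S x \<omega>"]) auto
          then show False using y \<open>\<not> t < S x \<omega>\<close> by simp
        qed
      qed
      then show False using lt by simp
    qed
  qed
  have gt: "prob {\<omega> \<in> space M. t < S x \<omega>} = 1 - wright_survival \<beta> (x * t powr (- \<beta>))"
  proof -
    have "prob {\<omega> \<in> space M. t < S x \<omega>} = 1 - prob {\<omega> \<in> space M. S x \<omega> \<le> t}"
      by (subst prob_compl [symmetric]) (auto intro!: arg_cong [where f=prob])
    then show ?thesis using prob_stable_subordinator_le [OF \<beta> S x t] by simp
  qed
  have "prob {\<omega> \<in> space M. t < S x \<omega>} \<le> prob {\<omega> \<in> space M. ?E \<omega> \<le> x}"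
    using 1 by (intro finite_measure_mono) auto
  moreover have "prob {\<omega> \<in> space M. ?E \<omega> \<le> x} \<le> prob ({\<omega> \<in> space M. ?E \<omega> = x} \<union> {\<omega> \<in> space M. t < S x \<omega>})"
    using 2 by (intro finite_measure_mono_AE) (auto elim!: eventually_mono)
  moreover have "\<dots> \<le> prob {\<omega> \<in> space M. ?E \<omega> = x} + prob {\<omega> \<in> space M. t < S x \<omega>}"
    by (intro measure_Un_le) auto
  ultimately show ?thesis using gt atom by simp
qed

text \<open>The distribution functions agree: for x > 0 both are 1 - W (x t^(-\<beta>)), and for x
  \<le> 0 both vanish. Equal laws determine their densities almost everywhere.\<close>

lemma inverse_subordinator_density_eq_M_Wright:
  assumes \<beta>: "0 < \<beta>" "\<beta> < 1" and S: "stable_subordinator \<beta> M S"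
    and q: "inverse_subordinator_density M S q" and t: "t > 0"
  shows "AE x in lborel. indicator {0<..} x * q x t = indicator {0<..} x * (t powr (- \<beta>) * M_Wright \<beta> (x * t powr (- \<beta>)))"
proof -
  interpret prob_space M by (rule stable_subordinatorD [OF S])
  note [measurable] = borel_measurable_M_Wright [OF \<beta>]
  define c where "c = t powr (- \<beta>)"
  have c: "c > 0" using t by (simp add: c_def)
  let ?E = "inverse_subordinator S t"
  let ?f = "\<lambda>x. ennreal (indicator {0<..} x * q x t)"
  let ?m = "\<lambda>x. indicator {0<..} x * (c * M_Wright \<beta> (x * c))"
  have q0: "\<And>x. x > 0 \<Longrightarrow> 0 \<le> q x t" and dist: "distributed M lborel ?E ?f"
    using q t by (auto simp: inverse_subordinator_density_def)
  have f [measurable]: "?f \<in> borel_measurable lborel" and E: "?E \<in> borel_measurable M"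
    and D: "distr M lborel ?E = density lborel ?f"
    using dist by (auto simp: distributed_def)
  note [measurable] = E
  note m = has_bochner_integral_M_Wright [OF \<beta> S c]
  have m0: "?m x \<ge> 0" for x
    using M_Wright_nonneg [OF \<beta> S] c by (auto simp: indicator_def)
  have Dm: "measure (density lborel ?f) A = prob {\<omega> \<in> space M. ?E \<omega> \<in> A}" if "A \<in> sets borel" for A
    unfolding D [symmetric] using that by (subst measure_distr) (auto intro!: arg_cong [where f=prob])
  have "prob_space (density lborel ?f)"
    unfolding D [symmetric] by (rule prob_space_distr) simp
  then interpret F: prob_space "density lborel ?f" .
  have mn: "emeasure (density lborel ?m) A = (\<integral>\<^sup>+x. ennreal (?m x) * indicator A x \<partial>lborel)" if "A \<in> sets borel" for A
    using that by (subst emeasure_density) auto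
  have "emeasure (density lborel ?m) UNIV = 1"
    using mn [of UNIV] nn_integral_eq_integral [of lborel ?m] m m0 by (simp add: has_bochner_integral_iff)
  then interpret G: prob_space "density lborel ?m"
    by (intro prob_spaceI) simp
  have "density lborel ?f = density lborel ?m"
  proof (rule cdf_unique)
    show "real_distribution (density lborel ?f)" "real_distribution (density lborel ?m)"
      by (auto simp: real_distribution_def real_distribution_axioms_def F.prob_space_axioms G.prob_space_axioms)
    show "cdf (density lborel ?f) = cdf (density lborel ?m)"
    proof
      fix x :: real
      show "cdf (density lborel ?f) x = cdf (density lborel ?m) x"
      proof (cases "x > 0")
        case True
        \<comment> \<open>A law with a density has no atoms; this supplies the hypothesis
          \<open>atom\<close> of \<open>prob_inverse_subordinator_le\<close>.\<close>
        have "emeasure (density lborel ?f) {x} = 0"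
        proof (subst emeasure_density [OF f])
          show "(\<integral>\<^sup>+y. ?f y * indicator {x} y \<partial>lborel) = 0"
            by (rule nn_integral_zero', rule eventually_mono [OF AE_lborel_singleton [of x]]) simp
        qed simp
        then have "prob {\<omega> \<in> space M. ?E \<omega> \<in> {x}} = 0"
          by (subst Dm [symmetric]) (auto simp: measure_def)
        then have "cdf (density lborel ?f) x = 1 - wright_survival \<beta> (x * c)"
          using prob_inverse_subordinator_le [OF \<beta> S t True E] Dm [of "{..x}"] by (simp add: cdf_def2 c_def)
        moreover have "emeasure (density lborel ?m) {..x} = (\<integral>\<^sup>+y. ennreal (c * M_Wright \<beta> (y * c)) * indicator {0..x} y \<partial>lborel)"
          unfolding mn [OF borel_closed [OF closed_atMost]]
          by (rule nn_integral_cong_AE) (use AE_lborel_singleton [of 0] in eventually_elim, auto simp: indicator_def)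
        then have "cdf (density lborel ?m) x = 1 - wright_survival \<beta> (x * c)"
          using nn_integral_M_Wright_atLeastAtMost [OF \<beta> S c, of x] True wright_survival_bounds [OF \<beta> S, of "x * c"] c
          by (simp add: cdf_def2 measure_def)
        ultimately show ?thesis by simp
      next
        case False
        have "emeasure (density lborel ?f) {..x} = 0" "emeasure (density lborel ?m) {..x} = 0"
          using False unfolding emeasure_density [OF f sets_lborel [THEN equalityD2, THEN subsetD, OF borel_closed [OF closed_atMost]]] mn [OF borel_closed [OF closed_atMost]]
          by (auto simp: indicator_def intro!: nn_integral_zero')
        then show ?thesis by (simp add: cdf_def2 measure_def)
      qed
    qed
  qed
  then have "AE x in lborel. ?f x = ennreal (?m x)"
    by (intro sigma_finite_measure.density_unique [OF lborel.sigma_finite_measure_axioms]) auto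
  then show ?thesis
  proof eventually_elim
    case (elim x)
    \<comment> \<open>Nonnegativity of both functions lifts the equation from \<open>ennreal\<close>
      to the reals.\<close>
    then show ?case
      using q0 [of x] m0 [of x] by (cases "x > 0") (auto simp: c_def)
  qed
qed

section \<open>Integration by parts against Erlang densities\<close>

lemma power_exp_div_fact_le_1:
  fixes x :: real
  assumes "x \<ge> 0"
  shows "x ^ n * exp (- x) / fact n \<le> 1"
proof -
  have "(\<lambda>n. x ^ n /\<^sub>R fact n) sums exp x" by (rule exp_converges)
  then have "x ^ n / fact n \<le> exp x"
    using sum_le_suminf [of "\<lambda>n. x ^ n /\<^sub>R fact n" "{n}"] assms by (simp add: sums_iff divide_inverse mult.commute)
  then show ?thesis by (simp add: exp_minus field_simps)
qed

text \<open>Let H n x = x^n e^(-x) / n!, the Erlang density of shape n + 1. Its derivative is H (n -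
  1) - H n, so integrating the derivative of H n x * W (x c) over the half-line gives the identity.
  The boundary value at 0 is 1 for n = 0 and 0 otherwise, whence the 1 in the case n = 0; it will
  match P (t_0 \<le> t) = 1.\<close>

lemma
  assumes \<beta>: "0 < \<beta>" "\<beta> < 1" and S: "stable_subordinator \<beta> M S" and c: "c > 0"
  shows integrable_erlang_M_Wright:
      "integrable lborel (\<lambda>x. indicator {0<..} x * (x ^ n * exp (- x) * (c * M_Wright \<beta> (x * c))))" (is ?int1)
    and integrable_erlang_wright_survival:
      "integrable lborel (\<lambda>x. indicator {0<..} x * (x ^ n * exp (- x) / fact n * wright_survival \<beta> (x * c)))" (is ?int2)
    and erlang_M_Wright_by_parts:
      "(LINT x|lborel. indicator {0<..} x * (x ^ n * exp (- x) * (c * M_Wright \<beta> (x * c)))) / fact n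
       = (if n = 0 then 1 else LINT x|lborel. indicator {0<..} x * (x ^ (n - 1) * exp (- x) / fact (n - 1) * wright_survival \<beta> (x * c)))
         - (LINT x|lborel. indicator {0<..} x * (x ^ n * exp (- x) / fact n * wright_survival \<beta> (x * c)))" (is ?eq)
proof -
  note [measurable] = borel_measurable_M_Wright [OF \<beta>] borel_measurable_wright_survival [OF \<beta>]
  define H where "H n x = x ^ n * exp (- x) / fact n" for n and x :: real
  define W where "W x = wright_survival \<beta> (x * c)" for x
  define m where "m x = c * M_Wright \<beta> (x * c)" for x
  have [measurable]: "H n \<in> borel_measurable borel" "W \<in> borel_measurable borel" "m \<in> borel_measurable borel" for n
    unfolding H_def [abs_def] W_def [abs_def] m_def [abs_def] by measurable
  have iH: "integrable lborel (\<lambda>x. indicator {0<..} x * H n x)" for n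
  proof -
    have "integrable lborel (\<lambda>x::real. indicator {0<..} x * (x ^ n * exp (- (1 * x))) / fact n)"
      using has_bochner_integral_power_exp [of 1 n] by (simp add: has_bochner_integral_iff)
    then show ?thesis by (simp add: H_def)
  qed
  have H: "H n x \<in> {0..1}" if "x > 0" for n x
    using power_exp_div_fact_le_1 [of x n] that by (simp add: H_def)
  have Wb: "W x \<in> {0..1}" if "x \<ge> 0" for x
    unfolding W_def using that c by (intro wright_survival_bounds [OF \<beta> S]) auto
  have iHW: "integrable lborel (\<lambda>x. indicator {0<..} x * (H n x * W x))" for n
  proof (rule Bochner_Integration.integrable_bound [OF iH [of n]])
    have "norm (indicator {0<..} x * (H n x * W x)) \<le> norm (indicator {0<..} x * H n x)" for x
      using Wb [of x] by (cases "x > 0") (auto simp: abs_mult mult_left_le)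
    then show "AE x in lborel. norm (indicator {0<..} x * (H n x * W x)) \<le> norm (indicator {0<..} x * H n x)" by simp
  qed measurable
  have im: "integrable lborel (\<lambda>x. indicator {0<..} x * m x)"
    using has_bochner_integral_M_Wright [OF \<beta> S c] by (simp add: has_bochner_integral_iff m_def)
  have iHm: "integrable lborel (\<lambda>x. indicator {0<..} x * (H n x * m x))" for n
  proof (rule Bochner_Integration.integrable_bound [OF im])
    have "norm (indicator {0<..} x * (H n x * m x)) \<le> norm (indicator {0<..} x * m x)" for x
      using H [of x n] by (cases "x > 0") (auto simp: abs_mult mult_left_le_one_le)
    then show "AE x in lborel. norm (indicator {0<..} x * (H n x * m x)) \<le> norm (indicator {0<..} x * m x)" by simp
  qed measurable
  have Hm: "x ^ n * exp (- x) * m x = fact n * (H n x * m x)" for x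
    by (simp add: H_def)
  have Hm': "indicator {0<..} x * (x ^ n * exp (- x) * m x) = fact n * (indicator {0<..} x * (H n x * m x))" for x
    unfolding Hm by (simp only: mult_ac)
  show ?int2 using iHW [of n] by (simp add: H_def W_def)
  have "integrable lborel (\<lambda>x. indicator {0<..} x * (x ^ n * exp (- x) * m x))"
    unfolding Hm' by (intro integrable_mult_right iHm)
  then show ?int1 by (simp only: m_def)
  \<comment> \<open>The convention H (-1) = 0 has to be explicit, since n - 1 on naturals is 0 again
    at n = 0.\<close>
  define D where "D x = (if n = 0 then 0 else H (n - 1) x) - H n x" for x
  have dH: "(H n has_real_derivative D x) (at x)" for x
  proof (cases n)
    case 0
    then show ?thesis by (auto simp: H_def [abs_def] D_def intro!: derivative_eq_intros)
  next
    case (Suc k)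
    have "((\<lambda>x. x ^ Suc k * exp (- x) / fact (Suc k)) has_real_derivative
       ((real (Suc k) * x ^ k) * exp (- x) + x ^ Suc k * (- exp (- x))) / fact (Suc k)) (at x)"
    proof (rule DERIV_cdivide)
      have "((\<lambda>x. exp (- x)) has_real_derivative - exp (- x)) (at x)"
        by (auto intro!: derivative_eq_intros)
      from DERIV_mult [OF DERIV_pow [of "Suc k" x UNIV] this]
      show "((\<lambda>x. x ^ Suc k * exp (- x)) has_real_derivative
          (real (Suc k) * x ^ k) * exp (- x) + x ^ Suc k * (- exp (- x))) (at x)"
        by (simp add: mult_ac del: power_Suc of_nat_Suc)
    qed
    moreover have "((real (Suc k) * x ^ k) * exp (- x) + x ^ Suc k * (- exp (- x))) / fact (Suc k)
       = x ^ k * exp (- x) / fact k - x ^ Suc k * exp (- x) / fact (Suc k)"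
    proof -
      have "(real (Suc k) * x ^ k) * exp (- x) / fact (Suc k) = x ^ k * exp (- x) / fact k"
        by (simp add: fact_Suc divide_simps del: of_nat_Suc)
      then show ?thesis by (simp only: add_divide_distrib)
    qed
    ultimately show ?thesis by (simp add: H_def [abs_def] D_def Suc del: power_Suc fact_Suc)
  qed
  have dF: "((\<lambda>x. H n x * W x) has_real_derivative D x * W x - H n x * m x) (at x)" for x
    using DERIV_mult [OF dH [of x] wright_survival_scaled_has_derivative [OF \<beta>, of c x]]
    by (simp add: W_def m_def mult.commute)
  have DW: "indicator {0<..} x * (D x * W x - H n x * m x)
     = (if n = 0 then 0 else indicator {0<..} x * (H (n - 1) x * W x)) - indicator {0<..} x * (H n x * W x) - indicator {0<..} x * (H n x * m x)" for x
    by (simp add: D_def algebra_simps)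
  have iDW: "integrable lborel (\<lambda>x. indicator {0<..} x * (D x * W x - H n x * m x))"
    unfolding DW using iHW [of n] iHW [of "n - 1"] iHm [of n] by (cases "n = 0") simp_all
  have contH: "isCont (H n) x" for n x
    unfolding H_def [abs_def] by (intro continuous_intros) auto
  have contW: "isCont W x" for x
    unfolding W_def [abs_def] by (intro isCont_o2 [OF _ isCont_wright_survival [OF \<beta>]] continuous_intros)
  have contm: "isCont m x" for x
    unfolding m_def [abs_def] by (intro isCont_o2 [OF _ isCont_M_Wright [OF \<beta>]] continuous_intros)
  have contD: "isCont D x" for x
    unfolding D_def [abs_def] using contH by (cases "n = 0") (auto intro!: continuous_intros)
  have "(LBINT x=ereal 0..\<infinity>. D x * W x - H n x * m x) = 0 - (if n = 0 then 1 else 0)"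
  proof (rule interval_integral_FTC_integrable [where F="\<lambda>x. H n x * W x"])
    show "((\<lambda>x. H n x * W x) has_vector_derivative D x * W x - H n x * m x) (at x)" for x
      using dF by (simp add: has_real_derivative_iff_has_vector_derivative)
    show "isCont (\<lambda>x. D x * W x - H n x * m x) x" for x
      by (intro continuous_intros contD contW contH contm)
    show "set_integrable lborel (einterval (ereal 0) \<infinity>) (\<lambda>x. D x * W x - H n x * m x)"
      using iDW by (simp add: set_integrable_def)
    have "isCont (\<lambda>x. H n x * W x) 0" by (intro continuous_intros contH contW)
    then have "((\<lambda>x. H n x * W x) \<longlongrightarrow> H n 0 * W 0) (at_right 0)"
      by (auto simp: isCont_def intro: filterlim_at_split [THEN iffD1, THEN conjunct2])
    moreover have "H n 0 * W 0 = (if n = 0 then 1 else 0)" by (simp add: H_def W_def)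
    ultimately show "(((\<lambda>x. H n x * W x) \<circ> real_of_ereal) \<longlongrightarrow> (if n = 0 then 1 else 0)) (at_right (ereal 0))"
      by (simp add: ereal_tendsto_simps)
    have "((\<lambda>x::real. x ^ n / exp x / fact n) \<longlongrightarrow> 0) at_top"
      by (intro tendsto_divide_zero tendsto_power_div_exp_0)
    then have H0: "(H n \<longlongrightarrow> 0) at_top"
      by (simp add: H_def [abs_def] exp_minus divide_inverse)
    have le: "eventually (\<lambda>x. norm (H n x * W x) \<le> H n x) at_top"
      using eventually_gt_at_top [of 0]
    proof eventually_elim
      case (elim x)
      then show ?case using H [of x n] Wb [of x] by (auto simp: abs_mult mult_left_le)
    qed
    have "((\<lambda>x. H n x * W x) \<longlongrightarrow> 0) at_top"
      by (rule Lim_null_comparison [OF le H0])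
    then show "(((\<lambda>x. H n x * W x) \<circ> real_of_ereal) \<longlongrightarrow> 0) (at_left \<infinity>)"
      by (simp add: ereal_tendsto_simps)
  qed auto
  then have "(LINT x|lborel. indicator {0<..} x * (D x * W x - H n x * m x)) = - (if n = 0 then 1 else 0)"
    by (simp add: interval_integral_to_infinity_eq set_lebesgue_integral_def)
  then have *: "(if n = 0 then 0 else LINT x|lborel. indicator {0<..} x * (H (n - 1) x * W x))
     - (LINT x|lborel. indicator {0<..} x * (H n x * W x)) - (LINT x|lborel. indicator {0<..} x * (H n x * m x)) = - (if n = 0 then 1 else 0)"
    unfolding DW using iHW [of n] iHW [of "n - 1"] iHm [of n] by (cases "n = 0") simp_all
  have "(LINT x|lborel. indicator {0<..} x * (x ^ n * exp (- x) * m x)) / fact n = (LINT x|lborel. indicator {0<..} x * (H n x * m x))"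
    unfolding Hm' by simp
  also have "\<dots> = (if n = 0 then 1 else LINT x|lborel. indicator {0<..} x * (H (n - 1) x * W x)) - (LINT x|lborel. indicator {0<..} x * (H n x * W x))"
    using * by (simp split: if_splits)
  finally show ?eq unfolding H_def W_def m_def .
qed

section \<open>The renewal process\<close>

text \<open>The n-th term has transform (-q)^n / s with q = s^(-\<beta>), so the sum is geometric.
  The restriction s > 1 is what makes q < 1.\<close>

lemma mittag_leffler_laplace:
  assumes \<beta>: "0 < \<beta>" and s: "s > 1"
  shows "has_bochner_integral lborel (\<lambda>t. indicator {0<..} t * (exp (- (s * t)) * mittag_leffler \<beta> (- (t powr \<beta>)))) (s powr \<beta> / (1 + s powr \<beta>) / s)"
proof -
  define f where "f n t = indicator {0<..} t * (exp (- (s * t)) * ((- (t powr \<beta>)) ^ n / Gamma (\<beta> * real n + 1)))" for n and t :: real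
  define q where "q = s powr (- \<beta>)"
  have q: "0 < q" "q < 1"
    using \<beta> s powr_less_mono [of "- \<beta>" 0 s] by (auto simp: q_def)
  have a: "\<beta> * real n + 1 > 0" for n using \<beta> by (simp add: add_nonneg_pos)
  have nf: "norm (f n t) = indicator {0<..} t * (t powr ((\<beta> * real n + 1) - 1) * exp (- (s * t))) / Gamma (\<beta> * real n + 1)" for n t
  proof (cases "t > 0")
    case True
    have "(t powr \<beta>) ^ n = t powr (\<beta> * real n)"
      using True by (simp add: powr_powr flip: powr_realpow)
    then show ?thesis
      using True Gamma_real_pos [OF a [of n]] by (simp add: f_def abs_mult power_abs)
  qed (simp add: f_def)
  have fn: "f n t = (- 1) ^ n * norm (f n t)" for n t
    using Gamma_real_pos [OF a [of n]] by (subst power_minus) (simp add: f_def abs_mult power_abs power_minus [of "t powr \<beta>"])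
  have inf: "has_bochner_integral lborel (\<lambda>t. norm (f n t)) (q ^ n / s)" for n
  proof -
    have "s powr (- (\<beta> * real n + 1)) = q ^ n / s"
      using s by (simp add: q_def powr_powr powr_diff powr_minus flip: powr_realpow powr_minus)
    then show ?thesis
      using has_bochner_integral_divide_zero [OF has_bochner_integral_powr_exp [OF a, of s n], of "Gamma (\<beta> * real n + 1)"] s Gamma_real_pos [OF a [of n]]
      unfolding nf by simp
  qed
  have inff: "has_bochner_integral lborel (f n) ((- 1) ^ n * (q ^ n / s))" for n
  proof -
    have "f n = (\<lambda>t. (- 1) ^ n * norm (f n t))" by (rule ext) (rule fn)
    then show ?thesis by (subst \<open>f n = _\<close>) (intro has_bochner_integral_mult_right inf)
  qed
  have sq: "summable (\<lambda>n. q ^ n / s)" using q by (intro summable_divide summable_geometric) simp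
  \<comment> \<open>Summability at almost every t comes from the finite sum of the L1 norms, which
    are q^n / s, rather than from the growth of Gamma.\<close>
  have AE: "AE t in lborel. summable (\<lambda>n. norm (f n t))"
  proof -
    have [measurable]: "f n \<in> borel_measurable lborel" for n
      using inff [of n] by (auto simp: has_bochner_integral_iff)
    have "(\<integral>\<^sup>+t. (\<Sum>n. ennreal (norm (f n t))) \<partial>lborel) = (\<Sum>n. \<integral>\<^sup>+t. ennreal (norm (f n t)) \<partial>lborel)"
      by (rule nn_integral_suminf) measurable
    also have "\<dots> = (\<Sum>n. ennreal (q ^ n / s))"
      using inf by (subst nn_integral_eq_integral) (auto simp: has_bochner_integral_iff)
    also have "\<dots> \<noteq> top"
      using sq q s by (subst suminf_ennreal2) auto
    finally have "AE t in lborel. (\<Sum>n. ennreal (norm (f n t))) \<noteq> \<infinity>"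
      by (intro nn_integral_PInf_AE) auto
    then show ?thesis
      by eventually_elim (auto intro: summable_suminf_not_top)
  qed
  have sn: "summable (\<lambda>n. LINT t|lborel. norm (f n t))"
    using inf sq by (simp add: has_bochner_integral_iff)
  have i: "integrable lborel (f n)" for n using inff by (simp add: has_bochner_integral_iff)
  have "(\<lambda>n. (- q) ^ n / s) sums (1 / (1 - (- q)) / s)"
    using q by (intro sums_divide geometric_sums) simp
  moreover have "(LINT t|lborel. f n t) = (- q) ^ n / s" for n
    using inff [of n] by (subst power_minus) (simp add: has_bochner_integral_iff)
  ultimately have "(LINT t|lborel. (\<Sum>n. f n t)) = 1 / (1 + q) / s"
    using integral_suminf [OF i AE sn] by (simp add: sums_iff)
  also have "1 / (1 + q) = s powr \<beta> / (1 + s powr \<beta>)"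
  proof -
    have "s powr \<beta> > 0" using s by simp
    then show ?thesis by (simp add: q_def powr_minus field_simps)
  qed
  finally have val: "(LINT t|lborel. (\<Sum>n. f n t)) = s powr \<beta> / (1 + s powr \<beta>) / s" .
  have AE_eq: "AE t in lborel. (\<Sum>n. f n t) = indicator {0<..} t * (exp (- (s * t)) * mittag_leffler \<beta> (- (t powr \<beta>)))"
    using AE
  proof eventually_elim
    case (elim t)
    show ?case
    proof (cases "t > 0")
      case True
      then have "summable (\<lambda>n. exp (- (s * t)) * ((- (t powr \<beta>)) ^ n / Gamma (\<beta> * real n + 1)))"
        using summable_norm_cancel [OF elim] by (simp add: f_def)
      then have "summable (\<lambda>n. (- (t powr \<beta>)) ^ n / Gamma (\<beta> * real n + 1))"
        by (subst (asm) summable_cmult_iff) simp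
      from suminf_mult [OF this, of "exp (- (s * t))"] show ?thesis
        using True by (simp add: f_def mittag_leffler_def)
    qed (simp add: f_def)
  qed
  have "has_bochner_integral lborel (\<lambda>t. \<Sum>n. f n t) (s powr \<beta> / (1 + s powr \<beta>) / s)"
    using integrable_suminf [OF i AE sn] val by (simp only: has_bochner_integral_iff)
  then show ?thesis
  proof (rule has_bochner_integralI_AE [OF _ _ AE_eq])
    show "(\<lambda>t. indicator {0<..} t * (exp (- (s * t)) * mittag_leffler \<beta> (- (t powr \<beta>)))) \<in> borel_measurable lborel"
      unfolding mittag_leffler_def by measurable
  qed
qed

text \<open>The transform of P (T \<le> t) is E exp (-s T) / s, and it is also 1/s minus the
  transform of the Mittag-Leffler function.\<close>

lemma (in prob_space) waiting_time_laplace: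
  fixes T :: "'a \<Rightarrow> real"
  assumes \<beta>: "0 < \<beta>" and s: "s > 1"
    and T [measurable]: "random_variable borel T" and pos: "AE \<omega> in M. 0 < T \<omega>"
    and surv: "\<And>t. t \<ge> 0 \<Longrightarrow> prob {\<omega> \<in> space M. t < T \<omega>} = mittag_leffler \<beta> (- (t powr \<beta>))"
  shows "expectation (\<lambda>\<omega>. exp (- s * T \<omega>)) = 1 / (1 + s powr \<beta>)"
proof -
  have s0: "s > 0" using s by simp
  have cdf: "prob {\<omega> \<in> space M. T \<omega> \<le> t} = 1 - mittag_leffler \<beta> (- (t powr \<beta>))" if "t > 0" for t
  proof -
    have "prob {\<omega> \<in> space M. T \<omega> \<le> t} = 1 - prob {\<omega> \<in> space M. t < T \<omega>}"
      by (subst prob_compl [symmetric]) (auto intro!: arg_cong [where f=prob])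
    then show ?thesis using surv that by simp
  qed
  have "AE \<omega> in M. 0 \<le> T \<omega>" using pos by eventually_elim simp
  note L = has_bochner_integral_laplace_prob_le [OF T this s0]
  have "has_bochner_integral lborel (\<lambda>t. indicator {0<..} t * (t ^ 0 * exp (- (s * t))) - indicator {0<..} t * (exp (- (s * t)) * mittag_leffler \<beta> (- (t powr \<beta>))))
     (fact 0 / s ^ Suc 0 - s powr \<beta> / (1 + s powr \<beta>) / s)"
    by (rule has_bochner_integral_diff [OF has_bochner_integral_power_exp [OF s0] mittag_leffler_laplace [OF \<beta> s]])
  also have "(\<lambda>t. indicator {0<..} t * (t ^ 0 * exp (- (s * t))) - indicator {0<..} t * (exp (- (s * t)) * mittag_leffler \<beta> (- (t powr \<beta>))))
     = (\<lambda>t. indicator {0<..} t * (exp (- (s * t)) * prob {\<omega> \<in> space M. T \<omega> \<le> t}))"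
    using cdf by (auto simp: fun_eq_iff indicator_def right_diff_distrib)
  finally have "expectation (\<lambda>\<omega>. exp (- s * T \<omega>)) / s = fact 0 / s ^ Suc 0 - s powr \<beta> / (1 + s powr \<beta>) / s"
    using L by (rule has_bochner_integral_eq [rotated])
  then have "expectation (\<lambda>\<omega>. exp (- s * T \<omega>)) / s = (1 - s powr \<beta> / (1 + s powr \<beta>)) / s"
    by (simp add: diff_divide_distrib)
  then have "expectation (\<lambda>\<omega>. exp (- s * T \<omega>)) = 1 - s powr \<beta> / (1 + s powr \<beta>)"
    using s0 by simp
  also have "\<dots> = 1 / (1 + s powr \<beta>)"
  proof -
    have "1 + s powr \<beta> \<noteq> 0" using powr_ge_zero [of s \<beta>] by linarith
    then show ?thesis by (simp add: divide_simps)
  qed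
  finally show ?thesis .
qed

lemma (in prob_space) renewal_time_laplace:
  fixes T :: "nat \<Rightarrow> 'a \<Rightarrow> real"
  assumes \<beta>: "0 < \<beta>" and s: "s > 1"
    and indep: "indep_vars (\<lambda>_. borel) T {1..}" and pos: "\<And>j. j \<ge> 1 \<Longrightarrow> AE \<omega> in M. 0 < T j \<omega>"
    and surv: "\<And>j t. j \<ge> 1 \<Longrightarrow> t \<ge> 0 \<Longrightarrow> prob {\<omega> \<in> space M. t < T j \<omega>} = mittag_leffler \<beta> (- (t powr \<beta>))"
  shows "expectation (\<lambda>\<omega>. exp (- s * renewal_time T n \<omega>)) = (1 / (1 + s powr \<beta>)) ^ n"
proof -
  have T [measurable]: "random_variable borel (T j)" if "j \<ge> 1" for j
    using indep that by (auto simp: indep_vars_def)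
  have "expectation (\<lambda>\<omega>. exp (- s * renewal_time T n \<omega>)) = expectation (\<lambda>\<omega>. \<Prod>j\<in>{1..n}. exp (- s * T j \<omega>))"
    by (simp only: renewal_time_def sum_distrib_left exp_sum finite_atLeastAtMost)
  also have "\<dots> = (\<Prod>j\<in>{1..n}. expectation (\<lambda>\<omega>. exp (- s * T j \<omega>)))"
  proof (rule indep_vars_lebesgue_integral)
    have "indep_vars (\<lambda>_. borel) T {1..n}"
      by (rule indep_vars_subset [OF indep]) auto
    then show "indep_vars (\<lambda>_. borel) (\<lambda>j \<omega>. exp (- s * T j \<omega>)) {1..n}"
      by (rule indep_vars_compose2 [where Y="\<lambda>_ x. exp (- s * x)"]) auto
    show "integrable M (\<lambda>\<omega>. exp (- s * T j \<omega>))" if "j \<in> {1..n}" for j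
      using pos [of j] that s by (intro integrable_const_bound [where B=1]) (auto elim!: eventually_mono)
  qed auto
  also have "\<dots> = (\<Prod>j\<in>{1..n}. 1 / (1 + s powr \<beta>))"
    using pos surv by (intro prod.cong refl waiting_time_laplace [OF \<beta> s]) auto
  finally show ?thesis by simp
qed

text \<open>Swapping the integrals and inserting the transform of W leaves x^k exp (-(1 + s^\<beta>)
  x) / k!, a Gamma integral in x. As W is nonnegative on the half-line, the same computation
  provides absolute integrability for Fubini.\<close>

lemma erlang_mixture_laplace:
  assumes \<beta>: "0 < \<beta>" "\<beta> < 1" and S: "stable_subordinator \<beta> M S" and s: "s > 0"
  shows "has_bochner_integral lborel (\<lambda>t. indicator {0<..} t * (exp (- (s * t)) *
      (LINT x|lborel. indicator {0<..} x * (x ^ k * exp (- x) / fact k * wright_survival \<beta> (x * t powr (- \<beta>))))))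
      ((1 / (1 + s powr \<beta>)) ^ Suc k / s)"
proof -
  note [measurable] = borel_measurable_wright_survival [OF \<beta>]
  define h where "h x = indicator {0<..} x * (x ^ k * exp (- x) / fact k)" for x :: real
  define w where "w x t = indicator {0<..} t * (exp (- (s * t)) * wright_survival \<beta> (x * t powr (- \<beta>)))" for x t
  define F where "F x t = h x * w x t" for x t
  have [measurable]: "h \<in> borel_measurable borel"
    unfolding h_def [abs_def] by measurable
  have h0: "h x \<ge> 0" for x by (simp add: h_def indicator_def)
  have w: "has_bochner_integral lborel (w x) (exp (- x * s powr \<beta>) / s)" if "x > 0" for x
    unfolding w_def by (rule wright_survival_laplace [OF \<beta> that s])
  have F0: "F x t \<ge> 0" for x t
    using h0 [of x] wright_survival_bounds [OF \<beta> S, of "x * t powr (- \<beta>)"]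
    by (cases "x > 0") (auto simp: F_def w_def indicator_def h_def)
  have iF: "has_bochner_integral lborel (F x) (h x * (exp (- x * s powr \<beta>) / s))" for x
  proof (cases "x > 0")
    case True
    then show ?thesis unfolding F_def by (intro has_bochner_integral_mult_right w)
  next
    case False
    then have "F x = (\<lambda>t. 0)" "h x = 0" by (auto simp: F_def h_def fun_eq_iff)
    then show ?thesis by (simp add: has_bochner_integral_zero)
  qed
  have [measurable]: "case_prod F \<in> borel_measurable (lborel \<Otimes>\<^sub>M lborel)"
    unfolding F_def w_def by measurable
  have c: "1 + s powr \<beta> > 0" using powr_ge_zero [of s \<beta>] by linarith
  have "has_bochner_integral lborel (\<lambda>x. indicator {0<..} x * (x ^ k * exp (- ((1 + s powr \<beta>) * x))) * (1 / (fact k * s))) (fact k / (1 + s powr \<beta>) ^ Suc k * (1 / (fact k * s)))"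
    by (intro has_bochner_integral_mult_left has_bochner_integral_power_exp c)
  also have "(\<lambda>x. indicator {0<..} x * (x ^ k * exp (- ((1 + s powr \<beta>) * x))) * (1 / (fact k * s))) = (\<lambda>x. h x * (exp (- x * s powr \<beta>) / s))"
  proof
    fix x :: real
    have "exp (- ((1 + s powr \<beta>) * x)) = exp (- x) * exp (- x * s powr \<beta>)"
      by (simp add: algebra_simps flip: exp_add)
    then show "indicator {0<..} x * (x ^ k * exp (- ((1 + s powr \<beta>) * x))) * (1 / (fact k * s)) = h x * (exp (- x * s powr \<beta>) / s)"
      by (simp add: h_def)
  qed
  also have "fact k / (1 + s powr \<beta>) ^ Suc k * (1 / (fact k * s)) = (1 / (1 + s powr \<beta>)) ^ Suc k / s"
    by (simp add: power_one_over)
  finally have outer: "has_bochner_integral lborel (\<lambda>x. h x * (exp (- x * s powr \<beta>) / s)) ((1 / (1 + s powr \<beta>)) ^ Suc k / s)" .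
  have int: "integrable (lborel \<Otimes>\<^sub>M lborel) (case_prod F)"
  proof (rule lborel_pair.Fubini_integrable)
    have "(LINT t|lborel. norm (case_prod F (x, t))) = h x * (exp (- x * s powr \<beta>) / s)" for x
      using iF [of x] F0 by (simp add: has_bochner_integral_iff)
    then show "integrable lborel (\<lambda>x. LINT t|lborel. norm (case_prod F (x, t)))"
      using outer by (simp only: has_bochner_integral_iff)
    show "AE x in lborel. integrable lborel (\<lambda>t. case_prod F (x, t))"
      using iF by (simp add: has_bochner_integral_iff)
  qed measurable
  have inner: "(LINT x|lborel. F x t) = indicator {0<..} t * (exp (- (s * t)) *
      (LINT x|lborel. indicator {0<..} x * (x ^ k * exp (- x) / fact k * wright_survival \<beta> (x * t powr (- \<beta>)))))" for t
  proof -
    have "F x t = (indicator {0<..} t * exp (- (s * t))) * (indicator {0<..} x * (x ^ k * exp (- x) / fact k * wright_survival \<beta> (x * t powr (- \<beta>))))" for x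
      by (simp add: F_def h_def w_def)
    then show ?thesis by simp
  qed
  have "(LINT t|lborel. (LINT x|lborel. F x t)) = (1 / (1 + s powr \<beta>)) ^ Suc k / s"
    using lborel_pair.Fubini_integral [OF int] iF outer by (simp add: has_bochner_integral_iff)
  then show ?thesis
    using lborel_pair.integrable_snd [OF int] by (simp only: inner has_bochner_integral_iff)
qed

text \<open>Dominated convergence: since W takes values in [0, 1], the Erlang density is a
  dominating function. This feeds the pointwise form of Laplace uniqueness.\<close>

lemma continuous_at_right_erlang_mixture:
  assumes \<beta>: "0 < \<beta>" "\<beta> < 1" and S: "stable_subordinator \<beta> M S" and t: "t > 0"
  shows "continuous (at_right t) (\<lambda>t. LINT x|lborel. indicator {0<..} x * (x ^ k * exp (- x) / fact k * wright_survival \<beta> (x * t powr (- \<beta>))))"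
  unfolding continuous_within tendsto_at_iff_sequentially comp_def
proof (intro allI impI)
  note [measurable] = borel_measurable_wright_survival [OF \<beta>]
  fix X :: "nat \<Rightarrow> real" assume X: "\<forall>i. X i \<in> {t<..} - {t}" "X \<longlonglongrightarrow> t"
  let ?f = "\<lambda>t x. indicator {0<..} x * (x ^ k * exp (- x) / fact k * wright_survival \<beta> (x * t powr (- \<beta>)))"
  show "(\<lambda>i. LINT x|lborel. ?f (X i) x) \<longlonglongrightarrow> (LINT x|lborel. ?f t x)"
  proof (rule integral_dominated_convergence)
    show "integrable lborel (\<lambda>x::real. indicator {0<..} x * (x ^ k * exp (- (1 * x))) / fact k)"
      using has_bochner_integral_power_exp [of 1 k] by (simp add: has_bochner_integral_iff)
    show "AE x in lborel. (\<lambda>i. ?f (X i) x) \<longlonglongrightarrow> ?f t x"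
    proof (intro always_eventually allI tendsto_mult tendsto_const)
      fix x
      show "(\<lambda>i. wright_survival \<beta> (x * X i powr - \<beta>)) \<longlonglongrightarrow> wright_survival \<beta> (x * t powr - \<beta>)"
        using X(2) t by (intro isCont_tendsto_compose [OF isCont_wright_survival [OF \<beta>]] tendsto_intros) auto
    qed
    show "AE x in lborel. norm (?f (X i) x) \<le> indicator {0<..} x * (x ^ k * exp (- (1 * x))) / fact k" for i
    proof (intro always_eventually allI)
      fix x
      show "norm (?f (X i) x) \<le> indicator {0<..} x * (x ^ k * exp (- (1 * x))) / fact k"
        using wright_survival_bounds [OF \<beta> S, of "x * X i powr - \<beta>"]
        by (cases "x > 0") (auto simp: abs_mult mult_left_le divide_right_mono)
    qed
  qed measurable
qed

section \<open>Distribution of the renewal times and of the counting process\<close>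

context prob_space
begin

text \<open>Both sides have the transform (1 + s^\<beta>)^(-(k + 1)) / s. It is known for the
  renewal time when s > 1, so the comparison starts at the integer 2. The index \<open>Suc k\<close>
  corresponds to the Erlang shape k + 1.\<close>

lemma prob_renewal_time_le:
  fixes T :: "nat \<Rightarrow> 'a \<Rightarrow> real"
  assumes \<beta>: "0 < \<beta>" "\<beta> < 1" and S: "stable_subordinator \<beta> M' S" and t: "t > 0"
    and indep: "indep_vars (\<lambda>_. borel) T {1..}" and pos: "\<And>j. j \<ge> 1 \<Longrightarrow> AE \<omega> in M. 0 < T j \<omega>"
    and surv: "\<And>j t. j \<ge> 1 \<Longrightarrow> t \<ge> 0 \<Longrightarrow> prob {\<omega> \<in> space M. t < T j \<omega>} = mittag_leffler \<beta> (- (t powr \<beta>))"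
  shows "prob {\<omega> \<in> space M. renewal_time T (Suc k) \<omega> \<le> t}
    = (LINT x|lborel. indicator {0<..} x * (x ^ k * exp (- x) / fact k * wright_survival \<beta> (x * t powr (- \<beta>))))"
proof -
  have [measurable]: "random_variable borel (T j)" if "j \<ge> 1" for j
    using indep that by (auto simp: indep_vars_def)
  have R [measurable]: "random_variable borel (renewal_time T (Suc k))"
    unfolding renewal_time_def by measurable
  have "AE \<omega> in M. \<forall>j\<in>{1..Suc k}. 0 < T j \<omega>"
    using pos by (intro AE_finite_allI) auto
  then have R0: "AE \<omega> in M. 0 \<le> renewal_time T (Suc k) \<omega>"
    unfolding renewal_time_def by eventually_elim (intro sum_nonneg, auto intro: less_imp_le)
  let ?P = "\<lambda>t. prob {\<omega> \<in> space M. renewal_time T (Suc k) \<omega> \<le> t}"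
  let ?I = "\<lambda>t. LINT x|lborel. indicator {0<..} x * (x ^ k * exp (- x) / fact k * wright_survival \<beta> (x * t powr (- \<beta>)))"
  have "has_bochner_integral lborel (\<lambda>t. indicator {0<..} t * (exp (- (real m * t)) * (?P t - ?I t))) 0" if "m \<ge> 2" for m :: nat
  proof -
    have m: "real m > 1" using that by simp
    then have m0: "real m > 0" by simp
    from has_bochner_integral_diff [OF has_bochner_integral_laplace_prob_le [OF R R0 m0] erlang_mixture_laplace [OF \<beta> S m0, of k]]
    show ?thesis
      using renewal_time_laplace [OF \<beta>(1) m indep pos surv, of "Suc k"]
      by (simp add: right_diff_distrib del: power_Suc)
  qed
  then have "?P t - ?I t = 0"
  proof (intro laplace_transform_unique_right_continuous [where g="\<lambda>t. ?P t - ?I t" and ?k0.0=2])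
    show "continuous (at_right t) (\<lambda>t. ?P t - ?I t)"
      by (intro continuous_diff continuous_at_right_prob_le continuous_at_right_erlang_mixture [OF \<beta> S t]) measurable
  qed (use t in \<open>auto simp: has_bochner_integral_iff\<close>)
  then show ?thesis by simp
qed

lemma AE_renewal_time_unbounded:
  fixes T :: "nat \<Rightarrow> 'a \<Rightarrow> real"
  assumes \<beta>: "0 < \<beta>"
    and indep: "indep_vars (\<lambda>_. borel) T {1..}" and pos: "\<And>j. j \<ge> 1 \<Longrightarrow> AE \<omega> in M. 0 < T j \<omega>"
    and surv: "\<And>j t. j \<ge> 1 \<Longrightarrow> t \<ge> 0 \<Longrightarrow> prob {\<omega> \<in> space M. t < T j \<omega>} = mittag_leffler \<beta> (- (t powr \<beta>))"
  shows "AE \<omega> in M. \<exists>n. t < renewal_time T n \<omega>"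
proof -
  have [measurable]: "random_variable borel (T j)" if "j \<ge> 1" for j
    using indep that by (auto simp: indep_vars_def)
  have R [measurable]: "random_variable borel (renewal_time T n)" for n
    unfolding renewal_time_def by measurable
  define B where "B = {\<omega> \<in> space M. \<forall>n. renewal_time T n \<omega> \<le> t}"
  have B [measurable]: "B \<in> events" unfolding B_def by measurable
  define p :: real where "p = 1 / (1 + 2 powr \<beta>)"
  have p: "0 \<le> p" "p < 1"
    unfolding p_def by (simp_all add: add_pos_pos)
  have le: "prob B \<le> exp (2 * t) * p ^ n" for n
  proof -
    have R0: "AE \<omega> in M. 0 \<le> renewal_time T n \<omega>"
    proof -
      have "AE \<omega> in M. \<forall>j\<in>{1..n}. 0 < T j \<omega>"
        using pos by (intro AE_finite_allI) auto
      then show ?thesis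
        unfolding renewal_time_def by eventually_elim (intro sum_nonneg, auto intro: less_imp_le)
    qed
    have int: "integrable M (\<lambda>\<omega>. exp (2 * t) * exp (- 2 * renewal_time T n \<omega>))"
      using R0 by (intro integrable_mult_right integrable_const_bound [where B=1]) auto
    have "prob B = expectation (indicator B)" by simp
    also have "\<dots> \<le> expectation (\<lambda>\<omega>. exp (2 * t) * exp (- 2 * renewal_time T n \<omega>))"
    proof (rule integral_mono [OF _ int])
      show "integrable M (indicator B :: 'a \<Rightarrow> real)" by (simp add: less_top [symmetric])
      show "indicator B \<omega> \<le> exp (2 * t) * exp (- 2 * renewal_time T n \<omega>)" for \<omega>
        by (auto simp: B_def indicator_def simp flip: exp_add)
    qed
    also have "\<dots> = exp (2 * t) * p ^ n"
      using renewal_time_laplace [OF \<beta> _ indep pos surv, of 2 n] by (simp add: p_def)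
    finally show ?thesis .
  qed
  have "(\<lambda>n. exp (2 * t) * p ^ n) \<longlonglongrightarrow> exp (2 * t) * 0"
    using p by (intro tendsto_mult tendsto_const LIMSEQ_realpow_zero) auto
  then have "prob B \<le> exp (2 * t) * 0"
    by (rule LIMSEQ_le_const) (use le in blast)
  then have "prob B = 0" by (simp add: measure_le_0_iff)
  then have "AE \<omega> in M. \<omega> \<notin> B" using prob_eq_0 [OF B] by simp
  then show ?thesis using AE_space by eventually_elim (auto simp: B_def not_le)
qed

text \<open>Almost surely the renewal times increase strictly and exceed t, so the maximum is n
  exactly when t_n \<le> t < t_(n+1). The event t_(n+1) \<le> t lies in t_n \<le> t up to a null
  set, hence the probabilities subtract.\<close>

lemma prob_Max_renewal_time:
  fixes T :: "nat \<Rightarrow> 'a \<Rightarrow> real"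
  assumes T: "\<And>j. j \<ge> 1 \<Longrightarrow> random_variable borel (T j)" and pos: "\<And>j. j \<ge> 1 \<Longrightarrow> AE \<omega> in M. 0 < T j \<omega>"
    and unb: "AE \<omega> in M. \<exists>n. t < renewal_time T n \<omega>" and t: "t \<ge> 0"
  shows "prob {\<omega> \<in> space M. Max {m. renewal_time T m \<omega> \<le> t} = n}
     = prob {\<omega> \<in> space M. renewal_time T n \<omega> \<le> t} - prob {\<omega> \<in> space M. renewal_time T (Suc n) \<omega> \<le> t}"
proof -
  note [measurable] = T
  have R [measurable]: "random_variable borel (renewal_time T n)" for n
    unfolding renewal_time_def by measurable
  let ?A = "\<lambda>\<omega>. {m. renewal_time T m \<omega> \<le> t}"
  have mem0: "0 \<in> ?A \<omega>" for \<omega> using t by (simp add: renewal_time_def)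
  have fin: "finite (?A \<omega>) \<longleftrightarrow> (\<exists>k. \<forall>m>k. \<not> renewal_time T m \<omega> \<le> t)" for \<omega>
    by (auto simp: finite_nat_set_iff_bounded_le not_le [symmetric])
  \<comment> \<open>The maximum of an infinite set is an unspecified constant, so the event is measurable also there.\<close>
  have Max: "Max (?A \<omega>) = n \<longleftrightarrow>
      (if \<exists>k. \<forall>m>k. \<not> renewal_time T m \<omega> \<le> t then renewal_time T n \<omega> \<le> t \<and> (\<forall>m>n. \<not> renewal_time T m \<omega> \<le> t)
       else the None = n)" for \<omega>
  proof (cases "finite (?A \<omega>)")
    case True
    have "Max (?A \<omega>) = n \<longleftrightarrow> n \<in> ?A \<omega> \<and> (\<forall>a\<in>?A \<omega>. a \<le> n)"
      using mem0 [of \<omega>] by (intro Max_eq_iff [OF True]) blast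
    also have "\<dots> \<longleftrightarrow> renewal_time T n \<omega> \<le> t \<and> (\<forall>m>n. \<not> renewal_time T m \<omega> \<le> t)"
      by (auto simp: not_le [symmetric])
    finally show ?thesis using True fin [of \<omega>] by simp
  next
    case False
    then have "\<not> (\<exists>k. \<forall>m>k. \<not> renewal_time T m \<omega> \<le> t)" unfolding fin .
    then show ?thesis by (simp only: if_False Max.infinite [OF False])
  qed
  let ?E = "{\<omega> \<in> space M. Max (?A \<omega>) = n}"
  have E: "?E \<in> events"
    unfolding Max by measurable
  have incr: "AE \<omega> in M. \<forall>i j. i < j \<longrightarrow> renewal_time T i \<omega> < renewal_time T j \<omega>"
  proof -
    have "AE \<omega> in M. \<forall>j. 0 < T (Suc j) \<omega>" using pos by (simp add: AE_all_countable)
    then show ?thesis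
    proof eventually_elim
      case (elim \<omega>)
      have "strict_mono (\<lambda>i. renewal_time T i \<omega>)"
        unfolding strict_mono_Suc_iff using elim by (simp add: renewal_time_def)
      then show ?case by (auto dest: strict_monoD)
    qed
  qed
  let ?L = "\<lambda>n. {\<omega> \<in> space M. renewal_time T n \<omega> \<le> t}"
  have "prob ?E = prob (?L n - ?L (Suc n))"
  proof (rule finite_measure_eq_AE)
    show "AE \<omega> in M. (\<omega> \<in> ?E) = (\<omega> \<in> ?L n - ?L (Suc n))"
      using incr unb AE_space
    proof eventually_elim
      case (elim \<omega>)
      have dc: "renewal_time T i \<omega> \<le> renewal_time T j \<omega>" if "i \<le> j" for i j
        using elim(1) that by (cases "i = j") (auto intro: less_imp_le)
      obtain k where k: "t < renewal_time T k \<omega>" using elim by blast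
      have "\<not> renewal_time T m \<omega> \<le> t" if "m > k" for m
        using dc [of k m] k that by linarith
      then have ex: "\<exists>k. \<forall>m>k. \<not> renewal_time T m \<omega> \<le> t" by blast
      have "\<not> renewal_time T m \<omega> \<le> t" if "\<not> renewal_time T (Suc n) \<omega> \<le> t" "m > n" for m
        using dc [of "Suc n" m] that by linarith
      then have iff: "(\<forall>m>n. \<not> renewal_time T m \<omega> \<le> t) \<longleftrightarrow> \<not> renewal_time T (Suc n) \<omega> \<le> t" by blast
      have "Max (?A \<omega>) = n \<longleftrightarrow> renewal_time T n \<omega> \<le> t \<and> \<not> renewal_time T (Suc n) \<omega> \<le> t"
        unfolding Max iff using ex by (simp only: if_True simp_thms)
      then show ?case using elim(3) by blast
    qed
  qed (use E in measurable)
  also have "\<dots> = prob (?L n) - prob (?L n \<inter> ?L (Suc n))"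
    by (subst finite_measure_Diff' [symmetric]) auto
  also have "prob (?L n \<inter> ?L (Suc n)) = prob (?L (Suc n))"
  proof (rule finite_measure_eq_AE)
    show "AE \<omega> in M. (\<omega> \<in> ?L n \<inter> ?L (Suc n)) = (\<omega> \<in> ?L (Suc n))"
      using incr
    proof eventually_elim
      case (elim \<omega>)
      then have "renewal_time T n \<omega> < renewal_time T (Suc n) \<omega>" by blast
      then show ?case by auto
    qed
  qed measurable
  finally show ?thesis .
qed

end

theorem corollary1:
  fixes \<beta> t :: real and n :: nat
    and M :: "'a measure" and N :: "real \<Rightarrow> 'a \<Rightarrow> nat"
    and M' :: "'b measure" and S :: "real \<Rightarrow> 'b \<Rightarrow> real"
    and q :: "real \<Rightarrow> real \<Rightarrow> real"
  assumes "0 < \<beta>" and "\<beta> < 1"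
    and "fractional_poisson_process \<beta> M N"
    and "stable_subordinator \<beta> M' S"
    and "inverse_subordinator_density M' S q"
    and "0 < t"
  shows "set_integrable lborel {0<..} (\<lambda>x. x ^ n * exp (- x) * q x t)
    \<and> measure M {\<omega> \<in> space M. N t \<omega> = n}
           = 1 / fact n * (LBINT x:{0<..}. x ^ n * exp (- x) * q x t)
    \<and> set_integrable lborel {0<..}
           (\<lambda>x. x ^ n * t powr (- \<beta>) * exp (- x) * M_Wright \<beta> (x * t powr (- \<beta>)))
    \<and> 1 / fact n * (LBINT x:{0<..}. x ^ n * exp (- x) * q x t)
           = 1 / fact n * (LBINT x:{0<..}.
               x ^ n * t powr (- \<beta>) * exp (- x) * M_Wright \<beta> (x * t powr (- \<beta>)))"
proof -
  note \<beta> = assms(1,2) and S = assms(4) and t = assms(6)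
  interpret prob_space M using assms(3) by (simp add: fractional_poisson_process_def)
  obtain T where indep: "indep_vars (\<lambda>_. borel) T {1..}"
    and pos: "\<And>j. j \<ge> 1 \<Longrightarrow> AE \<omega> in M. 0 < T j \<omega>"
    and surv: "\<And>j t. j \<ge> 1 \<Longrightarrow> t \<ge> 0 \<Longrightarrow> prob {\<omega> \<in> space M. t < T j \<omega>} = mittag_leffler \<beta> (- (t powr \<beta>))"
    and N: "\<And>t \<omega>. t \<ge> 0 \<Longrightarrow> \<omega> \<in> space M \<Longrightarrow> N t \<omega> = Max {n. renewal_time T n \<omega> \<le> t}"
    using assms(3) unfolding fractional_poisson_process_def by blast
  define c where "c = t powr (- \<beta>)"
  have c: "c > 0" using t by (simp add: c_def)
  let ?m = "\<lambda>x. indicator {0<..} x * (x ^ n * exp (- x) * (c * M_Wright \<beta> (x * c)))"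
  let ?q = "\<lambda>x. indicator {0<..} x *\<^sub>R (x ^ n * exp (- x) * q x t)"
  have m_eq: "indicator {0<..} x *\<^sub>R (x ^ n * t powr (- \<beta>) * exp (- x) * M_Wright \<beta> (x * t powr (- \<beta>))) = ?m x" for x
    by (simp add: c_def)
  have int_m: "integrable lborel ?m" by (rule integrable_erlang_M_Wright [OF \<beta> S c])
  have q_eq: "?q x = x ^ n * exp (- x) * (indicator {0<..} x * q x t)" for x by simp
  have "(\<lambda>x. ennreal (indicator {0<..} x * q x t)) \<in> borel_measurable lborel" "\<And>x. x > 0 \<Longrightarrow> q x t \<ge> 0"
    using assms(5) t by (auto simp: inverse_subordinator_density_def distributed_def)
  \<comment> \<open>Measurability is assumed for the \<open>ennreal\<close> version; for a
    nonnegative function \<open>enn2real\<close> recovers the real one.\<close>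
  then have [measurable]: "(\<lambda>x. indicator {0<..} x * q x t) \<in> borel_measurable borel"
    using distributed_real_measurable
    by (subst measurable_cong [where g="\<lambda>x. enn2real (ennreal (indicator {0<..} x * q x t))"]) (auto simp: indicator_def)
  have AE: "AE x in lborel. ?m x = ?q x"
    using inverse_subordinator_density_eq_M_Wright [OF \<beta> S assms(5) t]
    by eventually_elim (auto simp: c_def indicator_def)
  have meas_q: "?q \<in> borel_measurable lborel" unfolding q_eq by measurable
  have int_q: "integrable lborel ?q"
    by (rule integrable_cong_AE_imp [OF int_m meas_q AE])
  have eq: "(LINT x|lborel. ?q x) = (LINT x|lborel. ?m x)"
    by (rule integral_cong_AE [OF borel_measurable_integrable [OF int_m] meas_q AE, symmetric])
  have T: "random_variable borel (T j)" if "j \<ge> 1" for j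
    using indep that by (auto simp: indep_vars_def)
  have P0: "prob {\<omega> \<in> space M. renewal_time T 0 \<omega> \<le> t} = 1"
    using t by (simp add: renewal_time_def prob_space)
  have P: "prob {\<omega> \<in> space M. renewal_time T (Suc k) \<omega> \<le> t}
    = (LINT x|lborel. indicator {0<..} x * (x ^ k * exp (- x) / fact k * wright_survival \<beta> (x * c)))" for k
    unfolding c_def by (rule prob_renewal_time_le [OF \<beta> S t indep pos surv])
  have "prob {\<omega> \<in> space M. N t \<omega> = n} = prob {\<omega> \<in> space M. Max {m. renewal_time T m \<omega> \<le> t} = n}"
    using N [OF less_imp_le [OF t]] by (intro arg_cong [where f=prob] Collect_cong) auto
  also have "\<dots> = prob {\<omega> \<in> space M. renewal_time T n \<omega> \<le> t} - prob {\<omega> \<in> space M. renewal_time T (Suc n) \<omega> \<le> t}"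
    by (rule prob_Max_renewal_time [OF T pos AE_renewal_time_unbounded [OF \<beta>(1) indep pos surv] less_imp_le [OF t]])
  \<comment> \<open>For n = Suc k the two probabilities are the Erlang integrals with indices k and
    k + 1. For n = 0 the first one is \<open>P0\<close>, matching the 1 in
    \<open>erlang_M_Wright_by_parts\<close>.\<close>
  also have "\<dots> = (LINT x|lborel. ?m x) / fact n"
    unfolding erlang_M_Wright_by_parts [OF \<beta> S c] by (cases n) (simp_all only: P P0, simp_all)
  finally show ?thesis
    using int_m int_q eq by (simp add: set_integrable_def set_lebesgue_integral_def m_eq del: real_scaleR_def)
qed

end
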